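(* Let $\mathrm{cr}_{S^2}(K_n)$ denote the spherical geodesic crossing number of $K_n$, and let $H(n) := \frac{1}{4}\lfloor \frac{n}{2}\rfloor\lfloor \frac{n-1}{2}\rfloor\lfloor \frac{n-2}{2}\rfloor\lfloor \frac{n-3}{2}\rfloor$. Then \[ \lim_{n\to\infty} \frac{\mathrm{cr}_{S^2}(K_n)}{H(n)} > 0.99635588. \]
   Context: A spherical geodesic drawing of a graph places the vertices as points on the sphere and draws each edge as a minimum-distance geodesic arc joining its endpoints. The spherical geodesic crossing number $\mathrm{cr}_{S^2}(G)$ is the minimum number of crossings over all spherical geodesic drawings of $G$. *)

theory Defs
  imports "HOL-Analysis.Analysis"
begin

definition sphere_dist :: "real ^ 3 \<Rightarrow> real ^ 3 \<Rightarrow> real" where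
  "sphere_dist x y = arccos (x \<bullet> y)"

text \<open>A minimum-distance geodesic arc is the image of an isometric embedding of an interval
  into the sphere with its angular metric. It is determined by \<open>x\<close> and \<open>y\<close> unless these are
  antipodal, in which case every great semicircle joining them qualifies.\<close>

definition min_geodesic_arc :: "real ^ 3 \<Rightarrow> real ^ 3 \<Rightarrow> (real ^ 3) set \<Rightarrow> bool" where
  "min_geodesic_arc x y A \<longleftrightarrow>
    (\<exists>g :: real \<Rightarrow> real ^ 3.
       g 0 = x \<and> g (sphere_dist x y) = y \<and>
       g ` {0..sphere_dist x y} \<subseteq> sphere 0 1 \<and>
       (\<forall>s \<in> {0..sphere_dist x y}. \<forall>t \<in> {0..sphere_dist x y}.
          sphere_dist (g s) (g t) = \<bar>s - t\<bar>) \<and>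
       A = g ` {0..sphere_dist x y})"

text \<open>A simple graph is given by a vertex set \<open>V\<close> and a set \<open>E\<close> of two-element subsets of \<open>V\<close>.
  A drawing consists of the vertex positions \<open>p\<close> and the arcs \<open>a\<close>; the arcs are part of the
  data because of antipodal vertices. As usual for drawings, distinct vertices have distinct
  positions and no edge passes through a vertex other than its ends. For geodesic arcs this
  already implies that distinct edges do not overlap in an arc, so that every common interior
  point of two edges is a proper crossing.\<close>

definition spherical_geodesic_drawing ::
  "'v set \<Rightarrow> 'v set set \<Rightarrow> ('v \<Rightarrow> real ^ 3) \<Rightarrow> ('v set \<Rightarrow> (real ^ 3) set) \<Rightarrow> bool" where
  "spherical_geodesic_drawing V E p a \<longleftrightarrow>
    p ` V \<subseteq> sphere 0 1 \<and> inj_on p V \<and>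
    (\<forall>u v. {u, v} \<in> E \<longrightarrow> min_geodesic_arc (p u) (p v) (a {u, v})) \<and>
    (\<forall>e \<in> E. \<forall>w \<in> V - e. p w \<notin> a e)"

definition edge_interior ::
  "('v \<Rightarrow> real ^ 3) \<Rightarrow> ('v set \<Rightarrow> (real ^ 3) set) \<Rightarrow> 'v set \<Rightarrow> (real ^ 3) set" where
  "edge_interior p a e = a e - p ` e"

text \<open>A crossing is an unordered pair of edges together with a common interior point, so a
  point in the interior of \<open>k\<close> edges accounts for \<open>k choose 2\<close> crossings.\<close>

definition crossings ::
  "'v set set \<Rightarrow> ('v \<Rightarrow> real ^ 3) \<Rightarrow> ('v set \<Rightarrow> (real ^ 3) set) \<Rightarrow> ('v set set \<times> (real ^ 3)) set" where
  "crossings E p a =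
    {({e, f}, x) | e f x. e \<in> E \<and> f \<in> E \<and> e \<noteq> f \<and>
       x \<in> edge_interior p a e \<inter> edge_interior p a f}"

definition spherical_geodesic_crossing_number :: "'v set \<Rightarrow> 'v set set \<Rightarrow> nat" where
  "spherical_geodesic_crossing_number V E =
    (LEAST k. \<exists>p a. spherical_geodesic_drawing V E p a \<and> k = card (crossings E p a))"

definition complete_edges :: "nat \<Rightarrow> nat set set" where
  "complete_edges n = {e. e \<subseteq> {..<n} \<and> card e = 2}"

definition cr_S2_K :: "nat \<Rightarrow> nat" where
  "cr_S2_K n = spherical_geodesic_crossing_number {..<n} (complete_edges n)"

definition hill :: "nat \<Rightarrow> real" where
  "hill n = 1 / 4 * real_of_int \<lfloor>real n / 2\<rfloor> * real_of_int \<lfloor>(real n - 1) / 2\<rfloor>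
              * real_of_int \<lfloor>(real n - 2) / 2\<rfloor> * real_of_int \<lfloor>(real n - 3) / 2\<rfloor>"

end

theory Submission
  imports Defs "HOL-Real_Asymp.Real_Asymp"
begin

text \<open>
  Perturb the n vertices of a drawing to n vectors in general position. Four vectors span a crossing iff
  their linear dependency has two positive and two negative coefficients, and such a crossing comes from
  two arcs of the drawing that meet, unless one of the two edges joins antipodal vertices; at most
  \<open>n ^ 3\<close> quadruples are lost in this way. Choose a plane through the origin with n/2 vectors on
  either side, colour the vectors by their side and project them to an affine plane. If \<open>d i j\<close> is
  the number of vectors on one side of the plane spanned by i and j minus the number on the other side,
  and \<open>\<sigma>\<close> is the colour, then counting quadruples gives, up to terms of order \<open>n ^ 3\<close>,
  \<open>16 * crossings = n ^ 4 / 4 + (\<Sum>i<j. (1 + 3 * \<sigma> i * \<sigma> j) * (d i j)\<^sup>2)\<close>.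
  If the sum on the right is essentially nonnegative, then the limit is at least 1.

  The square is a sum over thresholds of truncated linear functions of the side counts. For each
  threshold the truncated sum does not increase when the leftmost point v of the projection is deleted:
  projecting v to infinity and dualising turns the other points into coloured lines, which are swept
  from left to right. Two lines of different colours that cross at high level either keep a large rank
  difference until the end of the sweep, where such pairs are counted by the terms of v, or lose it at
  a crossing of two lines of the same colour at high level, which determines the pair.
\<close>

section \<open>Ranks\<close>

definition rank_wrt :: "('a \<Rightarrow> 'a \<Rightarrow> bool) \<Rightarrow> 'a set \<Rightarrow> 'a \<Rightarrow> nat" where
  "rank_wrt R X i = card {k \<in> X. R k i}"

locale strict_linorder_on =
  fixes A :: "'a set" and R :: "'a \<Rightarrow> 'a \<Rightarrow> bool"
  assumes transp: "transp_on A R" and irreflp: "irreflp_on A R" and totalp: "totalp_on A R"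
begin

lemma rank_less_iff:
  assumes "finite X" "X \<subseteq> A" "k \<in> X" "i \<in> A"
  shows "rank_wrt R X k < rank_wrt R X i \<longleftrightarrow> R k i"
proof
  assume "R k i"
  have "{m \<in> X. R m k} \<subset> {m \<in> X. R m i}"
  proof (rule psubsetI)
    show "{m \<in> X. R m k} \<subseteq> {m \<in> X. R m i}"
      using assms \<open>R k i\<close> by (blast intro: transp_onD[OF transp])
    show "{m \<in> X. R m k} \<noteq> {m \<in> X. R m i}"
      using assms \<open>R k i\<close> irreflp by (blast dest: irreflp_onD)
  qed
  then show "rank_wrt R X k < rank_wrt R X i"
    unfolding rank_wrt_def using assms by (intro psubset_card_mono) auto
next
  assume *: "rank_wrt R X k < rank_wrt R X i"
  show "R k i"
  proof (rule ccontr)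
    assume "\<not> R k i"
    then have "i = k \<or> R i k" using totalp assms by (auto simp: totalp_on_def)
    then have "{m \<in> X. R m i} \<subseteq> {m \<in> X. R m k}"
      using assms by (blast intro: transp_onD[OF transp])
    then have "rank_wrt R X i \<le> rank_wrt R X k"
      unfolding rank_wrt_def using assms by (intro card_mono) auto
    with * show False by simp
  qed
qed

lemma inj_on_rank:
  assumes "finite X" "X \<subseteq> A"
  shows "inj_on (rank_wrt R X) X"
proof (rule inj_onI, rule ccontr)
  fix i j assume "i \<in> X" "j \<in> X" "rank_wrt R X i = rank_wrt R X j" "i \<noteq> j"
  moreover from this have "R i j \<or> R j i" using assms totalp by (blast dest: totalp_onD)
  ultimately show False
    using assms rank_less_iff[OF assms, of i j] rank_less_iff[OF assms, of j i] by auto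
qed

lemma bij_betw_rank:
  assumes "finite X" "X \<subseteq> A"
  shows "bij_betw (rank_wrt R X) X {..<card X}"
proof -
  have "rank_wrt R X i < card X" if "i \<in> X" for i
    unfolding rank_wrt_def using that assms irreflp
    by (intro psubset_card_mono) (auto simp: irreflp_on_def)
  then have "rank_wrt R X ` X = {..<card X}"
    using assms inj_on_rank by (intro card_subset_eq) (auto simp: card_image)
  then show ?thesis using assms inj_on_rank by (simp add: bij_betw_def)
qed

lemma card_rank_between:
  assumes "finite X" "X \<subseteq> A" "n \<le> card X"
  shows "card {k \<in> X. m \<le> rank_wrt R X k \<and> rank_wrt R X k < n} = n - m"
proof -
  have "rank_wrt R X ` {k \<in> X. m \<le> rank_wrt R X k \<and> rank_wrt R X k < n} = rank_wrt R X ` X \<inter> {m..<n}"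
    by auto
  then have "rank_wrt R X ` {k \<in> X. m \<le> rank_wrt R X k \<and> rank_wrt R X k < n} = {m..<n}"
    using bij_betw_imp_surj_on[OF bij_betw_rank[OF assms(1,2)]] assms(3) by auto
  moreover have "inj_on (rank_wrt R X) {k \<in> X. m \<le> rank_wrt R X k \<and> rank_wrt R X k < n}"
    using inj_on_rank[OF assms(1,2)] by (rule inj_on_subset) auto
  ultimately show ?thesis using card_image by fastforce
qed

lemma rank_add_rank_conversep:
  assumes "finite X" "X \<subseteq> A" "i \<in> A"
  shows "rank_wrt R X i + rank_wrt (\<lambda>j k. R k j) X i = card (X - {i})"
proof -
  have "X - {i} = {k \<in> X. R k i} \<union> {k \<in> X. R i k}"
    using assms irreflp totalp by (blast dest: irreflp_onD totalp_onD)
  moreover have "{k \<in> X. R k i} \<inter> {k \<in> X. R i k} = {}"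
    using assms irreflp by (blast dest: irreflp_onD transp_onD[OF transp])
  ultimately show ?thesis
    unfolding rank_wrt_def using assms by (simp add: card_Un_disjoint)
qed

end

lemma finite_set_first_change:
  fixes S :: "'a :: linorder set"
  assumes "finite S" and start: "r \<in> S" "Q r" and stop: "u \<in> S" "\<not> Q u" "r < u"
  obtains s t where "r \<le> s" "s < t" "S \<inter> {s<..<t} = {}" "Q s" "\<not> Q t"
proof -
  define t where "t = Min {t \<in> S. r < t \<and> \<not> Q t}"
  have "t \<in> {t \<in> S. r < t \<and> \<not> Q t}"
    unfolding t_def using assms by (intro Min_in) auto
  then have t_in: "t \<in> S" "r < t" "\<not> Q t" by auto
  have t_min: "t \<le> x" if "x \<in> S" "r < x" "\<not> Q x" for x
    unfolding t_def using that \<open>finite S\<close> by (intro Min_le) auto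
  define s where "s = Max {s \<in> S. s < t}"
  have "s \<in> {s \<in> S. s < t}"
    unfolding s_def using \<open>finite S\<close> start t_in by (intro Max_in) auto
  then have s_in: "s \<in> S" "s < t" by auto
  have s_max: "x \<le> s" if "x \<in> S" "x < t" for x
    unfolding s_def using that \<open>finite S\<close> by (intro Max_ge) auto
  have "r \<le> s" using s_max start(1) t_in(2) by blast
  moreover from this have "Q s" using t_min[OF s_in(1)] s_in(2) start(2) by force
  moreover have "S \<inter> {s<..<t} = {}" using s_max by force
  ultimately show thesis using that s_in(2) t_in(3) by blast
qed

section \<open>Sweeping an arrangement of bicoloured lines\<close>

locale bicolored_lines =
  fixes P N :: "'a set" and \<alpha> \<beta> :: "'a \<Rightarrow> real"
  assumes finite_P: "finite P" and finite_N: "finite N" and disjoint: "P \<inter> N = {}"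
    and inj_slope: "inj_on \<alpha> (P \<union> N)"
    and nonconcurrent: "\<And>i j k t. \<lbrakk>i \<in> P \<union> N; j \<in> P \<union> N; k \<in> P \<union> N; i \<noteq> j; j \<noteq> k; i \<noteq> k;
      \<alpha> i * t + \<beta> i = \<alpha> j * t + \<beta> j\<rbrakk> \<Longrightarrow> \<alpha> k * t + \<beta> k \<noteq> \<alpha> j * t + \<beta> j"
begin

definition height :: "'a \<Rightarrow> real \<Rightarrow> real" where
  "height i t = \<alpha> i * t + \<beta> i"

definition meet :: "'a \<Rightarrow> 'a \<Rightarrow> real" where
  "meet i j = (\<beta> j - \<beta> i) / (\<alpha> i - \<alpha> j)"

definition level :: "'a \<Rightarrow> 'a \<Rightarrow> nat" where
  "level i j = card {k \<in> P - {i, j}. height k (meet i j) < height i (meet i j)}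
             + card {k \<in> N - {i, j}. height i (meet i j) < height k (meet i j)}"

definition below_after :: "real \<Rightarrow> 'a \<Rightarrow> 'a \<Rightarrow> bool" where
  "below_after t i j \<longleftrightarrow> height i t < height j t \<or> height i t = height j t \<and> \<alpha> i < \<alpha> j"

definition below_before :: "real \<Rightarrow> 'a \<Rightarrow> 'a \<Rightarrow> bool" where
  "below_before t i j \<longleftrightarrow> height i t < height j t \<or> height i t = height j t \<and> \<alpha> j < \<alpha> i"

definition below_finally :: "'a \<Rightarrow> 'a \<Rightarrow> bool" where
  "below_finally i j \<longleftrightarrow> \<alpha> i < \<alpha> j"

lemma slope_neq: "\<lbrakk>i \<in> P \<union> N; j \<in> P \<union> N; i \<noteq> j\<rbrakk> \<Longrightarrow> \<alpha> i \<noteq> \<alpha> j"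
  using inj_slope by (meson inj_onD)

lemma slope_total: "\<lbrakk>i \<in> P \<union> N; j \<in> P \<union> N; i \<noteq> j\<rbrakk> \<Longrightarrow> \<alpha> i < \<alpha> j \<or> \<alpha> j < \<alpha> i"
  using slope_neq by (meson linorder_neqE_linordered_idom)

lemma meet_commute: "meet i j = meet j i"
  unfolding meet_def by (metis minus_diff_eq minus_divide_divide)

lemma height_diff:
  assumes "\<alpha> i \<noteq> \<alpha> j"
  shows "height j t - height i t = (\<alpha> j - \<alpha> i) * (t - meet i j)"
proof -
  have "(\<alpha> j - \<alpha> i) * meet i j = \<beta> i - \<beta> j"
    using assms by (simp add: meet_def field_simps)
  then show ?thesis by (simp add: height_def algebra_simps)
qed

lemma height_eq_iff: "\<alpha> i \<noteq> \<alpha> j \<Longrightarrow> height i t = height j t \<longleftrightarrow> t = meet i j"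
  using height_diff[of i j t] by auto

lemma height_less_iff:
  assumes "\<alpha> i \<noteq> \<alpha> j"
  shows "height i t < height j t \<longleftrightarrow> (if \<alpha> i < \<alpha> j then meet i j < t else t < meet i j)"
proof -
  have "height i t < height j t \<longleftrightarrow> 0 < (\<alpha> j - \<alpha> i) * (t - meet i j)"
    using height_diff[OF assms, of t] by auto
  then show ?thesis using assms by (auto simp: zero_less_mult_iff)
qed

lemma below_after_iff:
  "\<alpha> i \<noteq> \<alpha> j \<Longrightarrow> below_after t i j \<longleftrightarrow> (if \<alpha> i < \<alpha> j then meet i j \<le> t else t < meet i j)"
  using height_less_iff[of i j t] height_eq_iff[of i j t] by (auto simp: below_after_def)

lemma below_before_iff:
  "\<alpha> i \<noteq> \<alpha> j \<Longrightarrow> below_before t i j \<longleftrightarrow> (if \<alpha> i < \<alpha> j then meet i j < t else t \<le> meet i j)"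
  using height_less_iff[of i j t] height_eq_iff[of i j t] by (auto simp: below_before_def)

lemma not_below_self [simp]:
  "\<not> below_after t i i" "\<not> below_before t i i" "\<not> below_finally i i"
  by (simp_all add: below_after_def below_before_def below_finally_def)

lemma below_before_eq_below_after:
  assumes "i \<in> P \<union> N" "j \<in> P \<union> N" "s < t" "meet i j \<notin> {s<..<t}"
  shows "below_before t i j \<longleftrightarrow> below_after s i j"
proof (cases "i = j")
  case False
  then have "\<alpha> i \<noteq> \<alpha> j" using slope_neq assms by blast
  then show ?thesis using assms(3,4) by (auto simp: below_before_iff below_after_iff)
qed simp

lemma below_after_eq_below_finally:
  assumes "i \<in> P \<union> N" "j \<in> P \<union> N" "meet i j < t"
  shows "below_after t i j \<longleftrightarrow> below_finally i j"
proof (cases "i = j")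
  case False
  then have "\<alpha> i \<noteq> \<alpha> j" using slope_neq assms by blast
  then show ?thesis using assms(3) by (simp add: below_after_iff below_finally_def)
qed simp

lemma height_eq_imp:
  assumes "i \<in> P \<union> N" "j \<in> P \<union> N" "k \<in> P \<union> N" "i \<noteq> j"
    "height i t = height j t" "height k t = height j t"
  shows "k = i \<or> k = j"
  using nonconcurrent[of i j k t] assms unfolding height_def by metis

lemma level_commute:
  assumes "i \<in> P \<union> N" "j \<in> P \<union> N"
  shows "level i j = level j i"
proof (cases "i = j")
  case False
  then have "height i (meet i j) = height j (meet i j)"
    using slope_neq[OF assms] by (simp add: height_eq_iff)
  then show ?thesis by (simp add: level_def meet_commute[of j i] insert_commute)
qed simp

sublocale after: strict_linorder_on "P \<union> N" "below_after t"
  using slope_total by unfold_locales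
    (auto simp: transp_on_def irreflp_on_def totalp_on_def below_after_def)

sublocale before: strict_linorder_on "P \<union> N" "below_before t"
  using slope_total by unfold_locales
    (auto simp: transp_on_def irreflp_on_def totalp_on_def below_before_def)

sublocale final: strict_linorder_on "P \<union> N" below_finally
  using slope_total by unfold_locales
    (auto simp: transp_on_def irreflp_on_def totalp_on_def below_finally_def)

end

subsection \<open>Symmetries\<close>

context bicolored_lines
begin

lemma reversed: "bicolored_lines P N (\<lambda>i. - \<alpha> i) \<beta>"
proof
  fix i j k t assume "i \<in> P \<union> N" "j \<in> P \<union> N" "k \<in> P \<union> N" "i \<noteq> j" "j \<noteq> k" "i \<noteq> k"
    "- \<alpha> i * t + \<beta> i = - \<alpha> j * t + \<beta> j"
  then show "- \<alpha> k * t + \<beta> k \<noteq> - \<alpha> j * t + \<beta> j"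
    using nonconcurrent[of i j k "- t"] by simp
qed (use finite_P finite_N disjoint inj_slope in \<open>auto simp: inj_on_def\<close>)

lemma level_reversed: "bicolored_lines.level P N (\<lambda>i. - \<alpha> i) \<beta> i j = level i j"
proof -
  interpret R: bicolored_lines P N "\<lambda>i. - \<alpha> i" \<beta> by (rule reversed)
  have "R.height k (- t) = height k t" for k t by (simp add: R.height_def height_def)
  moreover have "R.meet i j = - meet i j"
    unfolding R.meet_def meet_def by (metis minus_diff_eq minus_diff_minus minus_divide_right)
  ultimately show ?thesis by (simp add: R.level_def level_def)
qed

lemma dual: "bicolored_lines N P (\<lambda>i. - \<alpha> i) (\<lambda>i. - \<beta> i)"
proof
  fix i j k t assume "i \<in> N \<union> P" "j \<in> N \<union> P" "k \<in> N \<union> P" "i \<noteq> j" "j \<noteq> k" "i \<noteq> k"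
    "- \<alpha> i * t + - \<beta> i = - \<alpha> j * t + - \<beta> j"
  then show "- \<alpha> k * t + - \<beta> k \<noteq> - \<alpha> j * t + - \<beta> j"
    using nonconcurrent[of i j k t] by auto
qed (use finite_P finite_N disjoint inj_slope in \<open>auto simp: inj_on_def\<close>)

interpretation D: bicolored_lines N P "\<lambda>i. - \<alpha> i" "\<lambda>i. - \<beta> i"
  by (rule dual)

lemma dual_height: "D.height i t = - height i t"
  by (simp add: D.height_def height_def)

lemma dual_meet: "D.meet i j = meet i j"
  unfolding D.meet_def meet_def by (metis minus_diff_eq minus_diff_minus minus_divide_divide)

lemma dual_level: "D.level i j = level i j"
  by (simp add: D.level_def level_def dual_meet dual_height)

lemma dual_below:
  "D.below_after t = (\<lambda>i j. below_after t j i)"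
  "D.below_before t = (\<lambda>i j. below_before t j i)"
  "D.below_finally = (\<lambda>i j. below_finally j i)"
  by (auto simp: fun_eq_iff D.below_after_def below_after_def D.below_before_def below_before_def
      D.below_finally_def below_finally_def dual_height)

end

subsection \<open>Pairs of lines of different colours\<close>

context bicolored_lines
begin

lemma falling_line_meets:
  assumes a_in: "a \<in> P" and falls: "rank_wrt (below_after t) P a < rank_wrt (below_before t) P a"
  obtains b where "b \<in> P" "\<alpha> a < \<alpha> b" "t = meet a b"
    "rank_wrt (below_before t) P a = Suc (rank_wrt (below_after t) P a)"
    "level a b = rank_wrt (below_after t) P a + card {k \<in> N. height a t < height k t}"
proof -
  let ?after = "{k \<in> P. below_after t k a}" and ?before = "{k \<in> P. below_before t k a}"
  have "\<not> ?before \<subseteq> ?after"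
    using falls finite_P by (auto simp: rank_wrt_def not_less dest!: card_mono[rotated])
  then obtain b where crosses: "b \<in> P" "below_before t b a" "\<not> below_after t b a" by blast
  then have meets: "height b t = height a t" "\<alpha> a < \<alpha> b"
    by (auto simp: below_before_def below_after_def)
  then have t_eq: "t = meet a b" using height_eq_iff[of a b t] by auto
  have only_meets: "k = b \<or> k = a" if "k \<in> P \<union> N" "height k t = height a t" for k
    using height_eq_imp[of b a k t] that a_in crosses(1) meets by auto
  have before: "?before = insert b ?after"
    using only_meets meets crosses by (fastforce simp: below_before_def below_after_def)
  have "{k \<in> P - {a, b}. height k t < height a t} = ?after"
    using only_meets meets by (fastforce simp: below_after_def)
  moreover have "{k \<in> N - {a, b}. height a t < height k t} = {k \<in> N. height a t < height k t}"
    using a_in crosses(1) disjoint by auto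
  ultimately have "level a b = rank_wrt (below_after t) P a + card {k \<in> N. height a t < height k t}"
    by (simp add: level_def rank_wrt_def flip: t_eq)
  moreover have "rank_wrt (below_before t) P a = Suc (rank_wrt (below_after t) P a)"
    unfolding rank_wrt_def before using finite_P crosses(3) by simp
  ultimately show thesis using that crosses(1) meets(2) t_eq by blast
qed

lemma rising_line_meets:
  assumes c_in: "c \<in> N" and rises: "rank_wrt (below_before t) N c < rank_wrt (below_after t) N c"
  obtains d where "d \<in> N" "\<alpha> d < \<alpha> c" "t = meet d c"
    "rank_wrt (below_after t) N c = Suc (rank_wrt (below_before t) N c)"
    "level d c + rank_wrt (below_after t) N c + 1 = card {k \<in> P. height k t < height c t} + card N"
proof -
  interpret D: bicolored_lines N P "\<lambda>i. - \<alpha> i" "\<lambda>i. - \<beta> i"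
    by (rule dual)
  have dual_rank:
    "rank_wrt (below_after t) N c + rank_wrt (D.below_after t) N c + 1 = card N"
    "rank_wrt (below_before t) N c + rank_wrt (D.below_before t) N c + 1 = card N"
    unfolding dual_below
    using after.rank_add_rank_conversep[of N c t] before.rank_add_rank_conversep[of N c t]
      card_Suc_Diff1[OF finite_N c_in] c_in finite_N by simp_all
  then have "rank_wrt (D.below_after t) N c < rank_wrt (D.below_before t) N c"
    using rises by linarith
  then obtain d where crosses: "d \<in> N" "- \<alpha> c < - \<alpha> d" "t = D.meet c d"
    "rank_wrt (D.below_before t) N c = Suc (rank_wrt (D.below_after t) N c)"
    "D.level c d = rank_wrt (D.below_after t) N c + card {k \<in> P. D.height c t < D.height k t}"
    using D.falling_line_meets c_in by blast
  show thesis
  proof (rule that[of d])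
    show "t = meet d c" using crosses(3) by (simp add: dual_meet meet_commute)
    show "level d c + rank_wrt (below_after t) N c + 1 = card {k \<in> P. height k t < height c t} + card N"
      using crosses(5) dual_rank(1) level_commute[of c d] c_in crosses(1)
      by (simp add: dual_level dual_height)
  qed (use crosses dual_rank in auto)
qed

definition high_pair :: "('a \<Rightarrow> 'a \<Rightarrow> bool) \<Rightarrow> nat \<Rightarrow> 'a \<Rightarrow> 'a \<Rightarrow> bool" where
  "high_pair R J a c \<longleftrightarrow> rank_wrt R N c + J < rank_wrt R P a + card N"

lemma high_pair_at_meet:
  assumes "a \<in> P" "c \<in> N"
  shows "high_pair (below_after (meet a c)) J a c \<longleftrightarrow> J \<le> level a c"
proof -
  let ?t = "meet a c"
  have "a \<noteq> c" using assms disjoint by blast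
  then have "\<alpha> a \<noteq> \<alpha> c" using slope_neq assms by blast
  then have meets: "height a ?t = height c ?t" by (simp add: height_eq_iff)
  have only_meets: "k = a \<or> k = c" if "k \<in> P \<union> N" "height k ?t = height c ?t" for k
    using height_eq_imp[of a c k ?t] that assms \<open>a \<noteq> c\<close> meets by auto
  have "{k \<in> P - {a, c}. height k ?t < height a ?t} = {k \<in> P. below_after ?t k a}"
    using only_meets meets assms disjoint by (fastforce simp: below_after_def)
  moreover have "{k \<in> N - {a, c}. height a ?t < height k ?t} = {k \<in> N. below_after ?t c k}"
    using only_meets meets assms disjoint by (fastforce simp: below_after_def)
  ultimately have "level a c = rank_wrt (below_after ?t) P a + rank_wrt (\<lambda>j k. below_after ?t k j) N c"
    by (simp add: level_def rank_wrt_def)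
  moreover have "rank_wrt (below_after ?t) N c + rank_wrt (\<lambda>j k. below_after ?t k j) N c + 1 = card N"
    using after.rank_add_rank_conversep[of N c ?t] card_Suc_Diff1[OF finite_N assms(2)] assms finite_N
    by simp
  ultimately show ?thesis unfolding high_pair_def by linarith
qed

lemma high_pair_lost:
  assumes a_in: "a \<in> P" and c_in: "c \<in> N"
    and high: "high_pair (below_after (meet a c)) J a c" and low: "\<not> high_pair below_finally J a c"
  obtains t where "meet a c < t" "high_pair (below_before t) J a c" "\<not> high_pair (below_after t) J a c"
proof -
  define meets where "meets = (\<lambda>(i, j). meet i j) ` ((P \<union> N) \<times> (P \<union> N))"
  have finite_meets: "finite meets" using finite_P finite_N by (simp add: meets_def)
  have meet_mem: "meet i j \<in> meets" if "i \<in> P \<union> N" "j \<in> P \<union> N" for i j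
    using that by (auto simp: meets_def)
  define z where "z = Max meets + 1"
  have meet_less_z: "meet i j < z" if "i \<in> P \<union> N" "j \<in> P \<union> N" for i j
    using Max_ge[OF finite_meets meet_mem[OF that]] by (simp add: z_def)
  have high_pair_cong: "high_pair R J a c \<longleftrightarrow> high_pair R' J a c"
    if "\<And>i j. \<lbrakk>i \<in> P \<union> N; j \<in> P \<union> N\<rbrakk> \<Longrightarrow> R i j \<longleftrightarrow> R' i j" for R R'
  proof -
    have "{k \<in> N. R k c} = {k \<in> N. R' k c}" "{k \<in> P. R k a} = {k \<in> P. R' k a}"
      using that a_in c_in by auto
    then show ?thesis by (simp add: high_pair_def rank_wrt_def)
  qed
  have "\<not> high_pair (below_after z) J a c"
    using low high_pair_cong[of "below_after z" below_finally]
      below_after_eq_below_finally meet_less_z by blast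
  then obtain s t where change: "meet a c \<le> s" "s < t" "insert z meets \<inter> {s<..<t} = {}"
    "high_pair (below_after s) J a c" "\<not> high_pair (below_after t) J a c"
    using finite_set_first_change[of "insert z meets" "meet a c" "\<lambda>t. high_pair (below_after t) J a c" z]
      finite_meets meet_mem meet_less_z a_in c_in high by auto
  have "meet i j \<notin> {s<..<t}" if "i \<in> P \<union> N" "j \<in> P \<union> N" for i j
    using meet_mem[OF that] change(3) by auto
  then have "high_pair (below_before t) J a c"
    using high_pair_cong[of "below_before t" "below_after s"]
      below_before_eq_below_after[OF _ _ change(2)] change(4) by blast
  then show thesis using that[of t] change by simp
qed

definition high_same_pairs :: "nat \<Rightarrow> ('a \<times> 'a) set" where
  "high_same_pairs J = {(i, j). (i \<in> P \<and> j \<in> P \<or> i \<in> N \<and> j \<in> N) \<and> \<alpha> i < \<alpha> j \<and> J \<le> level i j}"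

definition high_mixed_pairs :: "nat \<Rightarrow> ('a \<times> 'a) set" where
  "high_mixed_pairs J = {(a, c). a \<in> P \<and> c \<in> N \<and> \<alpha> a < \<alpha> c \<and> J \<le> level a c}"

definition finally_high_pairs :: "nat \<Rightarrow> ('a \<times> 'a) set" where
  "finally_high_pairs J = {(a, c). a \<in> P \<and> c \<in> N \<and> \<alpha> a < \<alpha> c \<and> high_pair below_finally J a c}"

lemma finite_high_pairs [simp]:
  "finite (high_same_pairs J)" "finite (high_mixed_pairs J)" "finite (finally_high_pairs J)"
proof -
  have "finite ((P \<union> N) \<times> (P \<union> N))" using finite_P finite_N by simp
  then show "finite (high_same_pairs J)" "finite (high_mixed_pairs J)" "finite (finally_high_pairs J)"
    by (rule finite_subset[rotated];
        force simp: high_same_pairs_def high_mixed_pairs_def finally_high_pairs_def)+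
qed

text \<open>A pair (a, c) that ceases to be high is charged to the crossing of two lines of the same colour
  at which this happens. If crossings of both colours occur at that time, then those of P count as the
  earlier ones, whence the mixture of ranks before and after the crossing.\<close>

definition charged_to :: "nat \<Rightarrow> 'a \<times> 'a \<Rightarrow> 'a \<times> 'a \<Rightarrow> bool" where
  "charged_to J = (\<lambda>(a, c) (i, j).
      i = a \<and> j \<in> P \<and>
        rank_wrt (below_before (meet i j)) N c + J = rank_wrt (below_after (meet i j)) P i + card N
    \<or> j = c \<and> i \<in> N \<and>
        rank_wrt (below_after (meet i j)) N j + J = rank_wrt (below_after (meet i j)) P a + card N)"

lemma lost_pair_charged_falling:
  assumes a_in: "a \<in> P" and c_in: "c \<in> N" and below: "height a t < height c t"
    and before: "high_pair (below_before t) J a c"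
    and mixed: "rank_wrt (below_after t) P a + card N \<le> rank_wrt (below_before t) N c + J"
  shows "\<exists>z \<in> high_same_pairs J. charged_to J (a, c) z"
proof -
  have "rank_wrt (below_after t) P a < rank_wrt (below_before t) P a"
    using before mixed unfolding high_pair_def by linarith
  then obtain b where crosses: "b \<in> P" "\<alpha> a < \<alpha> b" "t = meet a b"
    "rank_wrt (below_before t) P a = Suc (rank_wrt (below_after t) P a)"
    "level a b = rank_wrt (below_after t) P a + card {k \<in> N. height a t < height k t}"
    using falling_line_meets a_in by blast
  have "N = {k \<in> N. height a t < height k t} \<union> {k \<in> N. below_before t k c}"
    using below by (auto simp: below_before_def)
  then have "card N \<le> card {k \<in> N. height a t < height k t} + rank_wrt (below_before t) N c"
    unfolding rank_wrt_def by (metis card_Un_le)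
  then have "rank_wrt (below_before t) N c + J = rank_wrt (below_after t) P a + card N" "J \<le> level a b"
    using mixed before crosses(4,5) unfolding high_pair_def by linarith+
  then show ?thesis
    using a_in crosses(1-3) by (intro bexI[of _ "(a, b)"]) (auto simp: charged_to_def high_same_pairs_def)
qed

lemma lost_pair_charged_rising:
  assumes a_in: "a \<in> P" and c_in: "c \<in> N" and below: "height a t < height c t"
    and after: "\<not> high_pair (below_after t) J a c"
    and mixed: "rank_wrt (below_before t) N c + J < rank_wrt (below_after t) P a + card N"
  shows "\<exists>z \<in> high_same_pairs J. charged_to J (a, c) z"
proof -
  have "rank_wrt (below_before t) N c < rank_wrt (below_after t) N c"
    using after mixed unfolding high_pair_def by linarith
  then obtain d where crosses: "d \<in> N" "\<alpha> d < \<alpha> c" "t = meet d c"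
    "rank_wrt (below_after t) N c = Suc (rank_wrt (below_before t) N c)"
    "level d c + rank_wrt (below_after t) N c + 1 = card {k \<in> P. height k t < height c t} + card N"
    using rising_line_meets c_in by blast
  have "Suc (rank_wrt (below_after t) P a) = card (insert a {k \<in> P. below_after t k a})"
    using finite_P by (simp add: rank_wrt_def)
  also have "\<dots> \<le> card {k \<in> P. height k t < height c t}"
    using a_in below finite_P by (intro card_mono) (auto simp: below_after_def)
  finally have "rank_wrt (below_after t) N c + J = rank_wrt (below_after t) P a + card N" "J \<le> level d c"
    using mixed after crosses(4,5) unfolding high_pair_def by linarith+
  then show ?thesis
    using c_in crosses(1-3) by (intro bexI[of _ "(d, c)"]) (auto simp: charged_to_def high_same_pairs_def)
qed

lemma lost_pair_charged:
  assumes "a \<in> P" "c \<in> N" "\<alpha> a < \<alpha> c" "meet a c < t"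
    and "high_pair (below_before t) J a c" "\<not> high_pair (below_after t) J a c"
  shows "\<exists>z \<in> high_same_pairs J. charged_to J (a, c) z"
proof -
  have "height a t < height c t" using assms(3,4) by (simp add: height_less_iff)
  then show ?thesis
    using assms lost_pair_charged_falling lost_pair_charged_rising by (meson not_le)
qed

lemma charged_to_inj:
  assumes "a \<in> P" "c \<in> N" "a' \<in> P" "c' \<in> N" "z \<in> high_same_pairs J"
    "charged_to J (a, c) z" "charged_to J (a', c') z"
  shows "(a, c) = (a', c')"
proof -
  obtain i j where z_eq: "z = (i, j)" by (cases z)
  have "i \<in> P \<and> j \<in> P \<or> i \<in> N \<and> j \<in> N" using assms(5) by (auto simp: z_eq high_same_pairs_def)
  then show ?thesis
  proof (elim disjE conjE)
    assume "i \<in> P" "j \<in> P"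
    then have "i = a" "i = a'"
      "rank_wrt (below_before (meet i j)) N c = rank_wrt (below_before (meet i j)) N c'"
      using assms(6,7) disjoint by (auto simp: z_eq charged_to_def)
    then show ?thesis
      using before.inj_on_rank[of N "meet i j"] finite_N assms(2,4) by (auto dest: inj_onD)
  next
    assume "i \<in> N" "j \<in> N"
    then have "j = c" "j = c'"
      "rank_wrt (below_after (meet i j)) P a = rank_wrt (below_after (meet i j)) P a'"
      using assms(6,7) disjoint by (auto simp: z_eq charged_to_def)
    then show ?thesis
      using after.inj_on_rank[of P "meet i j"] finite_P assms(1,3) by (auto dest: inj_onD)
  qed
qed

lemma card_high_mixed_pairs_le:
  "card (high_mixed_pairs J) \<le> card (high_same_pairs J) + card (finally_high_pairs J)"
proof -
  have "card (high_mixed_pairs J - finally_high_pairs J) \<le> card (high_same_pairs J)"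
  proof (rule card_le_if_inj_on_rel[where r = "charged_to J"])
    fix x assume "x \<in> high_mixed_pairs J - finally_high_pairs J"
    then obtain a c where lost_pair: "x = (a, c)" "a \<in> P" "c \<in> N" "\<alpha> a < \<alpha> c" "J \<le> level a c"
      "\<not> high_pair below_finally J a c"
      by (auto simp: high_mixed_pairs_def finally_high_pairs_def)
    then obtain t where "meet a c < t" "high_pair (below_before t) J a c" "\<not> high_pair (below_after t) J a c"
      using high_pair_lost[OF lost_pair(2,3)] high_pair_at_meet by blast
    then show "\<exists>z. z \<in> high_same_pairs J \<and> charged_to J x z"
      using lost_pair_charged lost_pair(1-4) by blast
  next
    fix x y z
    assume "x \<in> high_mixed_pairs J - finally_high_pairs J" "y \<in> high_mixed_pairs J - finally_high_pairs J"
      and charged: "z \<in> high_same_pairs J" "charged_to J x z" "charged_to J y z"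
    then obtain a c a' c' where "x = (a, c)" "y = (a', c')" "a \<in> P" "c \<in> N" "a' \<in> P" "c' \<in> N"
      by (auto simp: high_mixed_pairs_def)
    then show "x = y" using charged_to_inj charged by blast
  qed simp
  then show ?thesis using diff_card_le_card_Diff[of "finally_high_pairs J" "high_mixed_pairs J"] by simp
qed

definition final_level :: "'a \<Rightarrow> nat" where
  "final_level i = card {k \<in> P. \<alpha> k < \<alpha> i} + card {k \<in> N. \<alpha> i < \<alpha> k}"

lemma card_finally_high_pairs_P:
  assumes "card P \<le> J + 1"
  shows "card (finally_high_pairs J) = (\<Sum>a\<in>P. final_level a - J)"
proof -
  let ?rank = "rank_wrt below_finally"
  have partners: "card {c \<in> N. \<alpha> a < \<alpha> c \<and> high_pair below_finally J a c} = final_level a - J"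
    if a_in: "a \<in> P" for a
  proof -
    have a_notin: "a \<notin> N" using a_in disjoint by blast
    have "?rank P a < card P"
      using final.bij_betw_rank[of P] finite_P a_in by (auto simp: bij_betw_def)
    then have bound: "?rank P a + card N - J \<le> card N" using assms by linarith
    have above: "\<alpha> a < \<alpha> c \<longleftrightarrow> ?rank N a \<le> ?rank N c" if "c \<in> N" for c
      using final.rank_less_iff[of N c a] slope_total[of a c] that a_in a_notin finite_N
      by (auto simp: below_finally_def)
    have "{c \<in> N. \<alpha> a < \<alpha> c \<and> high_pair below_finally J a c}
        = {c \<in> N. ?rank N a \<le> ?rank N c \<and> ?rank N c < ?rank P a + card N - J}"
      using above by (auto simp: high_pair_def)
    then have "card {c \<in> N. \<alpha> a < \<alpha> c \<and> high_pair below_finally J a c} = ?rank P a + card N - J - ?rank N a"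
      using final.card_rank_between[OF finite_N _ bound] by simp
    moreover have "final_level a + ?rank N a = ?rank P a + card N"
      using final.rank_add_rank_conversep[of N a] a_in a_notin finite_N
      by (simp add: final_level_def rank_wrt_def below_finally_def)
    ultimately show ?thesis by linarith
  qed
  have "finally_high_pairs J = (SIGMA a:P. {c \<in> N. \<alpha> a < \<alpha> c \<and> high_pair below_finally J a c})"
    by (auto simp: finally_high_pairs_def)
  then show ?thesis using finite_P finite_N partners by simp
qed

lemma card_finally_high_pairs_N:
  assumes "card N \<le> J + 1"
  shows "card (finally_high_pairs J) = (\<Sum>c\<in>N. final_level c - J)"
proof -
  interpret D: bicolored_lines N P "\<lambda>i. - \<alpha> i" "\<lambda>i. - \<beta> i"
    by (rule dual)
  have "D.high_pair D.below_finally J c a \<longleftrightarrow> high_pair below_finally J a c" if "a \<in> P" "c \<in> N" for a c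
  proof -
    have "rank_wrt below_finally P a + rank_wrt D.below_finally P a + 1 = card P"
      "rank_wrt below_finally N c + rank_wrt D.below_finally N c + 1 = card N"
      unfolding dual_below
      using final.rank_add_rank_conversep[of P a] final.rank_add_rank_conversep[of N c]
        card_Suc_Diff1[OF finite_P that(1)] card_Suc_Diff1[OF finite_N that(2)] that finite_P finite_N
      by simp_all
    then show ?thesis unfolding high_pair_def D.high_pair_def by linarith
  qed
  then have "D.finally_high_pairs J = prod.swap ` finally_high_pairs J"
    by (auto simp: D.finally_high_pairs_def finally_high_pairs_def)
  then have "card (finally_high_pairs J) = card (D.finally_high_pairs J)"
    by (simp add: card_image)
  also have "\<dots> = (\<Sum>c\<in>N. D.final_level c - J)" by (rule D.card_finally_high_pairs_P[OF assms])
  also have "\<dots> = (\<Sum>c\<in>N. final_level c - J)" by (simp add: D.final_level_def final_level_def add.commute)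
  finally show ?thesis .
qed

end

section \<open>Side counts of coloured points\<close>

definition orient :: "('a \<Rightarrow> real) \<Rightarrow> ('a \<Rightarrow> real) \<Rightarrow> 'a \<Rightarrow> 'a \<Rightarrow> 'a \<Rightarrow> real" where
  "orient x y i j k = (x j - x i) * (y k - y i) - (x k - x i) * (y j - y i)"

lemma orient_same [simp]: "orient x y i i k = 0" "orient x y i k i = 0" "orient x y i k k = 0"
  by (auto simp: orient_def)

lemma orient_swap: "orient x y j i k = - orient x y i j k"
  by (simp add: orient_def algebra_simps)

lemma orient_rotate: "orient x y j k i = orient x y i j k"
  by (simp add: orient_def algebra_simps)

definition side_count :: "('a \<Rightarrow> real) \<Rightarrow> ('a \<Rightarrow> real) \<Rightarrow> ('a \<Rightarrow> real) \<Rightarrow> 'a set \<Rightarrow> 'a \<Rightarrow> 'a \<Rightarrow> nat" where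
  "side_count x y \<sigma> I i j = card {k \<in> I. \<sigma> k * orient x y i j k > 0}"

definition imbalance :: "('a \<Rightarrow> real) \<Rightarrow> ('a \<Rightarrow> real) \<Rightarrow> ('a \<Rightarrow> real) \<Rightarrow> nat \<Rightarrow> 'a set \<Rightarrow> real" where
  "imbalance x y \<sigma> J I =
    (\<Sum>i\<in>I. \<Sum>j\<in>I. (1 + 3 * \<sigma> i * \<sigma> j) * real (side_count x y \<sigma> I i j - J))"

lemma side_count_same [simp]: "side_count x y \<sigma> I i i = 0"
  by (simp add: side_count_def)

lemma imbalance_uminus: "imbalance x y (\<lambda>i. - \<sigma> i) J I = imbalance x y \<sigma> J I"
proof -
  have "side_count x y (\<lambda>i. - \<sigma> i) I i j = side_count x y \<sigma> I j i" for i j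
    by (simp add: side_count_def orient_swap[of x y j i])
  then have "imbalance x y (\<lambda>i. - \<sigma> i) J I
      = (\<Sum>i\<in>I. \<Sum>j\<in>I. (1 + 3 * \<sigma> j * \<sigma> i) * real (side_count x y \<sigma> I j i - J))"
    by (simp add: imbalance_def mult_ac)
  also have "\<dots> = imbalance x y \<sigma> J I" unfolding imbalance_def by (rule sum.swap)
  finally show ?thesis .
qed

locale colored_points =
  fixes x y \<sigma> :: "'a \<Rightarrow> real" and I :: "'a set"
  assumes finite_I: "finite I"
    and color: "\<And>i. i \<in> I \<Longrightarrow> \<sigma> i = 1 \<or> \<sigma> i = - 1"
    and inj_x: "inj_on x I"
    and orient_nonzero: "\<And>i j k. \<lbrakk>i \<in> I; j \<in> I; k \<in> I; i \<noteq> j; j \<noteq> k; i \<noteq> k\<rbrakk> \<Longrightarrow> orient x y i j k \<noteq> 0"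
begin

lemma colored_points_delete: "colored_points x y \<sigma> (I - {v})"
  by unfold_locales (use finite_I color inj_x orient_nonzero in \<open>auto intro: inj_on_diff\<close>)

lemma colored_points_uminus: "colored_points x y (\<lambda>i. - \<sigma> i) I"
  by unfold_locales (use finite_I color inj_x orient_nonzero in force)+

lemma leftmost_point_exists:
  assumes "I \<noteq> {}"
  obtains v where "v \<in> I" "\<And>a. \<lbrakk>a \<in> I; a \<noteq> v\<rbrakk> \<Longrightarrow> x v < x a"
proof -
  let ?v = "arg_min_on x I"
  have min: "?v \<in> I" "\<And>a. a \<in> I \<Longrightarrow> x ?v \<le> x a"
    using arg_min_if_finite[OF finite_I assms, of x] by (auto simp: not_less)
  then have "x ?v < x a" if "a \<in> I" "a \<noteq> ?v" for a
    using inj_x that by (metis inj_onD order_le_imp_less_or_eq)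
  then show thesis using that min(1) by blast
qed

end

locale leftmost_point = colored_points x y \<sigma> I for x y \<sigma> :: "'a \<Rightarrow> real" and I :: "'a set" +
  fixes v :: 'a
  assumes v_in: "v \<in> I" and left: "\<And>a. \<lbrakk>a \<in> I; a \<noteq> v\<rbrakk> \<Longrightarrow> x v < x a" and color_v: "\<sigma> v = 1"
begin

text \<open>The projective map that sends v to infinity in the vertical direction, followed by duality,
  takes the other points to lines.\<close>

definition positives :: "'a set" where
  "positives = {a \<in> I - {v}. \<sigma> a = 1}"

definition negatives :: "'a set" where
  "negatives = {a \<in> I - {v}. \<sigma> a = - 1}"

definition X :: "'a \<Rightarrow> real" where
  "X a = x a - x v"

definition Y :: "'a \<Rightarrow> real" where
  "Y a = y a - y v"

definition slope :: "'a \<Rightarrow> real" where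
  "slope a = - (Y a / X a)"

definition intercept :: "'a \<Rightarrow> real" where
  "intercept a = - (1 / X a)"

lemma positives_Un_negatives: "positives \<union> negatives = I - {v}"
  using color by (auto simp: positives_def negatives_def)

lemma color_positives: "a \<in> positives \<Longrightarrow> \<sigma> a = 1"
  and color_negatives: "a \<in> negatives \<Longrightarrow> \<sigma> a = - 1"
  by (simp_all add: positives_def negatives_def)

lemma insert_v: "I = insert v (positives \<union> negatives)" "v \<notin> positives \<union> negatives"
  using v_in positives_Un_negatives by auto

lemma X_pos: "a \<in> positives \<union> negatives \<Longrightarrow> X a > 0"
  using left positives_Un_negatives by (auto simp: X_def)

lemma orient_XY: "orient x y i j k = (X j - X i) * (Y k - Y i) - (X k - X i) * (Y j - Y i)"
  by (simp add: orient_def X_def Y_def)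

lemma orient_v:
  assumes "i \<in> positives \<union> negatives" "j \<in> positives \<union> negatives"
  shows "orient x y i j v = X i * X j * (slope i - slope j)"
  using X_pos[OF assms(1)] X_pos[OF assms(2)]
  by (simp add: orient_XY X_def[of v] Y_def[of v] slope_def field_simps)

lemma orient_v_sign_iff:
  assumes "i \<in> positives \<union> negatives" "j \<in> positives \<union> negatives"
  shows "orient x y i j v > 0 \<longleftrightarrow> slope j < slope i" "orient x y i j v < 0 \<longleftrightarrow> slope i < slope j"
  using orient_v[OF assms] X_pos[OF assms(1)] X_pos[OF assms(2)]
  by (auto simp: zero_less_mult_iff mult_less_0_iff)

lemma line_equation:
  "a \<in> positives \<union> negatives \<Longrightarrow> h * X a + t * Y a + 1 = X a * (h - (slope a * t + intercept a))"
  using X_pos[of a] by (simp add: slope_def intercept_def field_simps)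

sublocale L: bicolored_lines positives negatives slope intercept
proof
  show "finite positives" "finite negatives" "positives \<inter> negatives = {}"
    using finite_I by (auto simp: positives_def negatives_def)
  show "inj_on slope (positives \<union> negatives)"
  proof (rule inj_onI, rule ccontr)
    fix i j assume "i \<in> positives \<union> negatives" "j \<in> positives \<union> negatives" "slope i = slope j" "i \<noteq> j"
    then show False using orient_v[of i j] orient_nonzero[of i j v] v_in positives_Un_negatives by auto
  qed
  fix i j k t
  assume ijk: "i \<in> positives \<union> negatives" "j \<in> positives \<union> negatives" "k \<in> positives \<union> negatives"
      "i \<noteq> j" "j \<noteq> k" "i \<noteq> k"
    and meet_ij: "slope i * t + intercept i = slope j * t + intercept j"
  show "slope k * t + intercept k \<noteq> slope j * t + intercept j"
  proof
    assume meet_jk: "slope k * t + intercept k = slope j * t + intercept j"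
    define h where "h = slope j * t + intercept j"
    have collinear: "h * X i + t * Y i + 1 = 0" "h * X j + t * Y j + 1 = 0" "h * X k + t * Y k + 1 = 0"
      using line_equation ijk meet_ij meet_jk by (auto simp: h_def)
    then have "h * orient x y i j k = 0" "t * orient x y i j k = 0"
      unfolding orient_XY by algebra+
    moreover have "h \<noteq> 0 \<or> t \<noteq> 0" using collinear(1) by auto
    ultimately show False using orient_nonzero[of i j k] ijk positives_Un_negatives by auto
  qed
qed

sublocale R: bicolored_lines positives negatives "\<lambda>i. - slope i" intercept
  by (rule L.reversed)

lemma orient_sign_iff_height:
  assumes ij_in: "i \<in> positives \<union> negatives" "j \<in> positives \<union> negatives" and slopes: "slope j < slope i"
    and k_in: "k \<in> positives \<union> negatives"
  shows "orient x y i j k > 0 \<longleftrightarrow> L.height k (L.meet i j) < L.height i (L.meet i j)"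
    and "orient x y i j k < 0 \<longleftrightarrow> L.height i (L.meet i j) < L.height k (L.meet i j)"
proof -
  define t where "t = L.meet i j"
  define h where "h = L.height i t"
  have "h = L.height j t" using slopes by (simp add: h_def t_def L.height_eq_iff)
  then have on_line: "h * X i + t * Y i + 1 = 0" "h * X j + t * Y j + 1 = 0"
    using line_equation[OF ij_in(1), of h t] line_equation[OF ij_in(2), of h t]
    by (simp_all add: h_def L.height_def)
  have "(X j - X i) * (Y k - Y i) - (X k - X i) * (Y j - Y i)
      = (X i * Y j - X j * Y i) * (h * X k + t * Y k + 1)"
    using on_line by algebra
  then have factored: "orient x y i j k = orient x y i j v * X k * (h - L.height k t)"
    unfolding line_equation[OF k_in]
    by (simp add: orient_XY X_def[of v] Y_def[of v] L.height_def algebra_simps)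
  have "orient x y i j v * X k > 0" using X_pos[OF k_in] orient_v_sign_iff(1)[OF ij_in] slopes by simp
  from mult_less_cancel_left_pos[OF this, of 0 "h - L.height k t"]
    mult_less_cancel_left_pos[OF this, of "h - L.height k t" 0]
  show "orient x y i j k > 0 \<longleftrightarrow> L.height k (L.meet i j) < L.height i (L.meet i j)"
    and "orient x y i j k < 0 \<longleftrightarrow> L.height i (L.meet i j) < L.height k (L.meet i j)"
    by (simp_all add: factored flip: h_def t_def)
qed

lemma side_count_eq_level:
  assumes ij_in: "i \<in> positives \<union> negatives" "j \<in> positives \<union> negatives" and slopes: "slope j < slope i"
  shows "side_count x y \<sigma> (I - {v}) i j = L.level i j"
proof -
  let ?height = "\<lambda>k. L.height k (L.meet i j)"
  have meets: "?height i = ?height j" using slopes by (simp add: L.height_eq_iff)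
  have "{k \<in> I - {v}. \<sigma> k * orient x y i j k > 0}
      = {k \<in> positives. orient x y i j k > 0} \<union> {k \<in> negatives. orient x y i j k < 0}"
    by (subst (1) positives_Un_negatives[symmetric]) (auto simp: positives_def negatives_def)
  also have "{k \<in> positives. orient x y i j k > 0} = {k \<in> positives - {i, j}. ?height k < ?height i}"
    using orient_sign_iff_height(1)[OF assms] meets by auto
  also have "{k \<in> negatives. orient x y i j k < 0} = {k \<in> negatives - {i, j}. ?height i < ?height k}"
    using orient_sign_iff_height(2)[OF assms] meets by auto
  finally have "side_count x y \<sigma> (I - {v}) i j
      = card ({k \<in> positives - {i, j}. ?height k < ?height i}
          \<union> {k \<in> negatives - {i, j}. ?height i < ?height k})"
    by (simp add: side_count_def)
  also have "\<dots> = L.level i j"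
    unfolding L.level_def using L.finite_P L.finite_N L.disjoint by (intro card_Un_disjoint) auto
  finally show ?thesis .
qed

lemma side_count_delete:
  assumes ij_in: "i \<in> positives \<union> negatives" "j \<in> positives \<union> negatives"
  shows "side_count x y \<sigma> I i j = side_count x y \<sigma> (I - {v}) i j + of_bool (slope j < slope i)"
proof -
  have "{k \<in> I. \<sigma> k * orient x y i j k > 0} =
     (if slope j < slope i then insert v else id) {k \<in> I - {v}. \<sigma> k * orient x y i j k > 0}"
    using v_in color_v orient_v_sign_iff[OF ij_in] by auto
  then show ?thesis using finite_I by (simp add: side_count_def)
qed

lemma side_count_eq_final_level:
  assumes b_in: "b \<in> positives \<union> negatives"
  shows "side_count x y \<sigma> I v b = L.final_level b" "side_count x y \<sigma> I b v = R.final_level b"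
proof -
  have orient: "orient x y v b k > 0 \<longleftrightarrow> slope k < slope b" "orient x y v b k < 0 \<longleftrightarrow> slope b < slope k"
    if "k \<in> positives \<union> negatives" for k
    using orient_v_sign_iff[OF b_in that] orient_rotate[of x y b k v] by auto
  have card_Un: "card ({k \<in> positives. Q k} \<union> {k \<in> negatives. Q' k})
      = card {k \<in> positives. Q k} + card {k \<in> negatives. Q' k}" for Q Q'
    using L.finite_P L.finite_N L.disjoint by (intro card_Un_disjoint) auto
  have "{k \<in> I. \<sigma> k * orient x y v b k > 0}
      = {k \<in> positives. slope k < slope b} \<union> {k \<in> negatives. slope b < slope k}"
    using orient color by (subst insert_v(1)) (auto simp: positives_def negatives_def)
  then show "side_count x y \<sigma> I v b = L.final_level b"
    by (simp add: side_count_def L.final_level_def card_Un)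
  have "{k \<in> I. \<sigma> k * orient x y b v k > 0}
      = {k \<in> positives. slope b < slope k} \<union> {k \<in> negatives. slope k < slope b}"
    using orient color
    by (subst insert_v(1)) (auto simp: orient_swap[of x y b v] positives_def negatives_def)
  then show "side_count x y \<sigma> I b v = R.final_level b"
    by (simp add: side_count_def R.final_level_def card_Un)
qed

lemma imbalance_delete:
  "imbalance x y \<sigma> J I = imbalance x y \<sigma> J (I - {v})
    + (\<Sum>i\<in>I - {v}. \<Sum>j\<in>I - {v}. if slope j < slope i \<and> J \<le> L.level i j then 1 + 3 * \<sigma> i * \<sigma> j else 0)
    + (\<Sum>b\<in>I - {v}. (1 + 3 * \<sigma> b) * (real (L.final_level b - J) + real (R.final_level b - J)))"
proof -
  let ?A = "I - {v}"
  let ?g = "\<lambda>i j. (1 + 3 * \<sigma> i * \<sigma> j) * real (side_count x y \<sigma> I i j - J)"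
  have split: "(\<Sum>i\<in>I. f i) = f v + (\<Sum>i\<in>?A. f i)" for f :: "'a \<Rightarrow> real"
    using finite_I v_in by (rule sum.remove)
  have "imbalance x y \<sigma> J I = (\<Sum>b\<in>?A. ?g v b + ?g b v) + (\<Sum>i\<in>?A. \<Sum>j\<in>?A. ?g i j)"
    unfolding imbalance_def split by (simp add: sum.distrib)
  also have "(\<Sum>b\<in>?A. ?g v b + ?g b v)
      = (\<Sum>b\<in>?A. (1 + 3 * \<sigma> b) * (real (L.final_level b - J) + real (R.final_level b - J)))"
    using side_count_eq_final_level color_v
    by (intro sum.cong) (simp_all add: positives_Un_negatives distrib_left)
  also have "(\<Sum>i\<in>?A. \<Sum>j\<in>?A. ?g i j) = (\<Sum>i\<in>?A. \<Sum>j\<in>?A.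
      (1 + 3 * \<sigma> i * \<sigma> j) * real (side_count x y \<sigma> ?A i j - J)
      + (if slope j < slope i \<and> J \<le> L.level i j then 1 + 3 * \<sigma> i * \<sigma> j else 0))"
    using side_count_delete side_count_eq_level
    by (intro sum.cong) (auto simp: positives_Un_negatives Suc_diff_le algebra_simps not_le)
  finally show ?thesis by (simp add: imbalance_def sum.distrib)
qed

lemma sum_high_pairs:
  "(\<Sum>i\<in>I - {v}. \<Sum>j\<in>I - {v}. if slope j < slope i \<and> J \<le> L.level i j then 1 + 3 * \<sigma> i * \<sigma> j else 0)
    = 4 * real (card (L.high_same_pairs J)) - 2 * real (card (L.high_mixed_pairs J))
      - 2 * real (card (R.high_mixed_pairs J))"
proof -
  let ?w = "\<lambda>(i, j). 1 + 3 * \<sigma> i * \<sigma> j"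
  let ?S = "prod.swap ` L.high_same_pairs J" and ?L = "prod.swap ` L.high_mixed_pairs J"
    and ?R = "R.high_mixed_pairs J"
  let ?high = "\<lambda>z. slope (snd z) < slope (fst z) \<and> J \<le> L.level (fst z) (snd z)"
  have "(\<Sum>i\<in>I - {v}. \<Sum>j\<in>I - {v}. if slope j < slope i \<and> J \<le> L.level i j then 1 + 3 * \<sigma> i * \<sigma> j else 0)
      = (\<Sum>z\<in>(I - {v}) \<times> (I - {v}). if ?high z then ?w z else 0)"
    by (simp add: sum.cartesian_product case_prod_beta cong: if_cong)
  also have "\<dots> = sum ?w {z \<in> (I - {v}) \<times> (I - {v}). ?high z}"
    using finite_I by (intro sum.inter_filter[symmetric]) simp
  also have "{z \<in> (I - {v}) \<times> (I - {v}). ?high z} = ?S \<union> (?L \<union> ?R)"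
  proof (rule set_eqI)
    fix z :: "'a \<times> 'a"
    obtain i j where z_eq: "z = (i, j)" by (cases z)
    have "L.level j i = L.level i j" if "i \<in> positives \<union> negatives" "j \<in> positives \<union> negatives"
      using L.level_commute that by blast
    then show "z \<in> {z \<in> (I - {v}) \<times> (I - {v}). ?high z}
        \<longleftrightarrow> z \<in> ?S \<union> (?L \<union> ?R)"
      unfolding positives_Un_negatives[symmetric] z_eq
      by (auto simp: L.high_same_pairs_def L.high_mixed_pairs_def R.high_mixed_pairs_def L.level_reversed)
  qed
  also have "sum ?w \<dots> = sum ?w ?S + (sum ?w ?L + sum ?w ?R)"
  proof -
    have "?S \<inter> (?L \<union> ?R) = {}" "?L \<inter> ?R = {}"
      using L.disjoint by (auto simp: L.high_same_pairs_def L.high_mixed_pairs_def R.high_mixed_pairs_def)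
    then show ?thesis by (simp add: sum.union_disjoint)
  qed
  also have "sum ?w ?S = sum (\<lambda>_. 4) ?S"
    by (intro sum.cong) (auto simp: L.high_same_pairs_def color_positives color_negatives)
  also have "sum ?w ?L = sum (\<lambda>_. - 2) ?L"
    by (intro sum.cong) (auto simp: L.high_mixed_pairs_def color_positives color_negatives)
  also have "sum ?w ?R = sum (\<lambda>_. - 2) ?R"
    by (intro sum.cong) (auto simp: R.high_mixed_pairs_def color_positives color_negatives)
  finally show ?thesis by (simp add: card_image)
qed

lemma sum_final_levels:
  assumes "card positives \<le> J + 1" "card negatives \<le> J + 1"
  shows "(\<Sum>b\<in>I - {v}. (1 + 3 * \<sigma> b) * (real (L.final_level b - J) + real (R.final_level b - J)))
    = 2 * (real (card (L.finally_high_pairs J)) + real (card (R.finally_high_pairs J)))"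
proof -
  let ?u = "\<lambda>b. real (L.final_level b - J) + real (R.final_level b - J)"
  have "(\<Sum>b\<in>I - {v}. (1 + 3 * \<sigma> b) * ?u b)
      = (\<Sum>b\<in>positives. (1 + 3 * \<sigma> b) * ?u b) + (\<Sum>b\<in>negatives. (1 + 3 * \<sigma> b) * ?u b)"
    unfolding positives_Un_negatives[symmetric]
    using L.finite_P L.finite_N L.disjoint by (rule sum.union_disjoint)
  also have "(\<Sum>b\<in>positives. (1 + 3 * \<sigma> b) * ?u b) = (\<Sum>b\<in>positives. 4 * ?u b)"
    by (rule sum.cong) (simp_all add: color_positives)
  also have "(\<Sum>b\<in>negatives. (1 + 3 * \<sigma> b) * ?u b) = (\<Sum>b\<in>negatives. - 2 * ?u b)"
    by (rule sum.cong) (simp_all add: color_negatives)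
  also have "(\<Sum>b\<in>positives. 4 * ?u b) + (\<Sum>b\<in>negatives. - 2 * ?u b)
      = 4 * sum ?u positives - 2 * sum ?u negatives"
    by (simp only: sum_distrib_left[symmetric])
  also have "sum ?u positives = real (card (L.finally_high_pairs J)) + real (card (R.finally_high_pairs J))"
    using L.card_finally_high_pairs_P R.card_finally_high_pairs_P assms by (simp add: sum.distrib)
  also have "sum ?u negatives = real (card (L.finally_high_pairs J)) + real (card (R.finally_high_pairs J))"
    using L.card_finally_high_pairs_N R.card_finally_high_pairs_N assms by (simp add: sum.distrib)
  finally show ?thesis by simp
qed

lemma card_high_same_pairs_reversed: "card (R.high_same_pairs J) = card (L.high_same_pairs J)"
proof -
  have "R.high_same_pairs J = prod.swap ` L.high_same_pairs J"
    by (auto simp: L.high_same_pairs_def R.high_same_pairs_def L.level_reversed L.level_commute image_iff)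
  then show ?thesis by (simp add: card_image)
qed

lemma imbalance_delete_le:
  assumes "card positives \<le> J + 1" "card negatives \<le> J + 1"
  shows "imbalance x y \<sigma> J (I - {v}) \<le> imbalance x y \<sigma> J I"
proof -
  have "card (L.high_mixed_pairs J) + card (R.high_mixed_pairs J)
      \<le> 2 * card (L.high_same_pairs J) + (card (L.finally_high_pairs J) + card (R.finally_high_pairs J))"
    using L.card_high_mixed_pairs_le[of J] R.card_high_mixed_pairs_le[of J]
      card_high_same_pairs_reversed[of J]
    by linarith
  then have "real (card (L.high_mixed_pairs J)) + real (card (R.high_mixed_pairs J))
      \<le> 2 * real (card (L.high_same_pairs J))
        + (real (card (L.finally_high_pairs J)) + real (card (R.finally_high_pairs J)))"
    by (metis (mono_tags) of_nat_add of_nat_mono of_nat_mult of_nat_numeral)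
  then show ?thesis
    unfolding imbalance_delete[of J] sum_high_pairs sum_final_levels[OF assms] by argo
qed

end

lemma (in colored_points) imbalance_delete_leftmost_le:
  assumes v_in: "v \<in> I" and left: "\<And>a. \<lbrakk>a \<in> I; a \<noteq> v\<rbrakk> \<Longrightarrow> x v < x a"
    and cards: "card {i \<in> I - {v}. \<sigma> i = 1} \<le> J + 1" "card {i \<in> I - {v}. \<sigma> i = - 1} \<le> J + 1"
  shows "imbalance x y \<sigma> J (I - {v}) \<le> imbalance x y \<sigma> J I"
proof -
  consider (positive) "\<sigma> v = 1" | (negative) "\<sigma> v = - 1" using color v_in by blast
  then show ?thesis
  proof cases
    case positive
    interpret leftmost_point x y \<sigma> I v by unfold_locales (use v_in left positive in auto)
    show ?thesis using cards by (intro imbalance_delete_le) (simp_all add: positives_def negatives_def)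
  next
    case negative
    interpret leftmost_point x y "\<lambda>i. - \<sigma> i" I v
      by (intro leftmost_point.intro leftmost_point_axioms.intro colored_points_uminus)
        (use v_in left negative in auto)
    have "positives = {i \<in> I - {v}. \<sigma> i = - 1}" "negatives = {i \<in> I - {v}. \<sigma> i = 1}"
      by (auto simp: positives_def negatives_def)
    then show ?thesis using imbalance_delete_le[of J] cards by (simp add: imbalance_uminus)
  qed
qed

lemma imbalance_nonneg:
  assumes "colored_points x y \<sigma> I"
    and "card {i \<in> I. \<sigma> i = 1} \<le> J + 1" "card {i \<in> I. \<sigma> i = - 1} \<le> J + 1"
  shows "imbalance x y \<sigma> J I \<ge> 0"
  using assms
proof (induction "card I" arbitrary: I)
  case 0
  then have "I = {}" using colored_points.finite_I by fastforce
  then show ?case by (simp add: imbalance_def)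
next
  case (Suc n)
  interpret C: colored_points x y \<sigma> I by fact
  have "I \<noteq> {}" using Suc(2) by auto
  then obtain v where v_in: "v \<in> I" and left: "\<And>a. \<lbrakk>a \<in> I; a \<noteq> v\<rbrakk> \<Longrightarrow> x v < x a"
    using C.leftmost_point_exists by blast
  have "card {i \<in> I - {v}. \<sigma> i = c} \<le> card {i \<in> I. \<sigma> i = c}" for c
    using C.finite_I by (intro card_mono) auto
  then have cards: "card {i \<in> I - {v}. \<sigma> i = 1} \<le> J + 1" "card {i \<in> I - {v}. \<sigma> i = - 1} \<le> J + 1"
    using Suc(4,5) by (meson order_trans)+
  have "n = card (I - {v})" using Suc(2) v_in by simp
  then have "0 \<le> imbalance x y \<sigma> J (I - {v})" using Suc(1) C.colored_points_delete cards by blast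
  also have "\<dots> \<le> imbalance x y \<sigma> J I" using v_in left cards by (rule C.imbalance_delete_leftmost_le)
  finally show ?case .
qed

section \<open>Counting quadruples of coloured points\<close>

lemma sum_truncated_diff:
  assumes "e \<le> (m :: nat)"
  shows "(\<Sum>r\<le>m. real (e - r)) = real e * (real e + 1) / 2"
proof -
  have "(\<Sum>r\<le>m. real (e - r)) = (\<Sum>r\<le>e. real (e - r))"
    using assms by (intro sum.mono_neutral_right) auto
  also have "\<dots> = (\<Sum>r\<le>e. real r)"
    by (rule sum.reindex_bij_witness[of _ "\<lambda>r. e - r" "\<lambda>r. e - r"]) auto
  also have "\<dots> = real e * (real e + 1) / 2"
    using double_gauss_sum[of e, where 'a = real] by (simp add: atMost_atLeast0)
  finally show ?thesis .
qed

lemma sum_truncated_diff_pair: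
  assumes "L + R = 2 * a"
  shows "(\<Sum>r\<le>2 * a. real (L - (a + r)) + real (R - (a + r))) =
    ((real L - real R)\<^sup>2 + 2 * \<bar>real L - real R\<bar>) / 8"
  using assms
proof (induction L R rule: linorder_wlog)
  case (le R L)
  define e where "e = L - a"
  have e_eq: "L = a + e" "R = a - e" "e \<le> a" using le by (auto simp: e_def)
  have "(\<Sum>r\<le>2 * a. real (R - (a + r)) + real (L - (a + r))) = (\<Sum>r\<le>2 * a. real (e - r))"
    by (rule sum.cong) (auto simp: e_eq)
  also have "\<dots> = real e * (real e + 1) / 2" using e_eq by (intro sum_truncated_diff) simp
  also have "\<dots> = ((real R - real L)\<^sup>2 + 2 * \<bar>real R - real L\<bar>) / 8"
    using e_eq by (simp add: of_nat_diff power2_eq_square field_simps)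
  finally show ?case .
next
  case (sym L R)
  then show ?case by (simp add: add.commute power2_commute abs_minus_commute)
qed

lemma orient_four: "orient x y j k l - orient x y i k l + orient x y i j l - orient x y i j k = 0"
  by (simp add: orient_def algebra_simps)

lemma alternating_sum_nonzero:
  fixes a b c d :: real
  assumes "sgn b = - sgn a" "sgn c = sgn a" "sgn d = - sgn a" "a \<noteq> 0"
  shows "a - b + c - d \<noteq> 0"
  using assms by (auto simp: sgn_if split: if_splits)

text \<open>A, B, C, D are the signs of the four triples, so that (A, -B, C, -D) are the signs of the
  linear dependency of the four vectors. The last assumption holds because the coefficients of an
  affine dependency of the four projected points add up to 0.\<close>

lemma six_pairs_identity:
  fixes A B C D s1 s2 s3 s4 :: real
  assumes "s1 = 1 \<or> s1 = -1" "s2 = 1 \<or> s2 = -1" "s3 = 1 \<or> s3 = -1" "s4 = 1 \<or> s4 = -1"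
    and "A = 1 \<or> A = -1" "B = 1 \<or> B = -1" "C = 1 \<or> C = -1" "D = 1 \<or> D = -1"
    and "\<not> (s2 * B = - (s1 * A) \<and> s3 * C = s1 * A \<and> s4 * D = - (s1 * A))"
  shows "(1 + 3 * s1 * s2) * (D * C) - (1 + 3 * s1 * s3) * (D * B) + (1 + 3 * s1 * s4) * (C * B)
      + (1 + 3 * s2 * s3) * (D * A) - (1 + 3 * s2 * s4) * (C * A) + (1 + 3 * s3 * s4) * (B * A)
    = 8 * (of_bool (B = - A \<and> C = - A \<and> D = A) + of_bool (B = A \<and> C = A \<and> D = A)
        + of_bool (B = A \<and> C = - A \<and> D = - A)) - 3 + 3 * (s1 * s2 * s3 * s4)"
  using assms by (elim disjE; simp)

definition sum4 :: "'a set \<Rightarrow> ('a \<Rightarrow> 'a \<Rightarrow> 'a \<Rightarrow> 'a \<Rightarrow> real) \<Rightarrow> real" where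
  "sum4 I g = (\<Sum>i\<in>I. \<Sum>j\<in>I. \<Sum>k\<in>I. \<Sum>l\<in>I. g i j k l)"

lemma sum4_swap12: "sum4 I (\<lambda>i j k l. g j i k l) = sum4 I g"
  unfolding sum4_def by (rule sum.swap)

lemma sum4_swap23: "sum4 I (\<lambda>i j k l. g i k j l) = sum4 I g"
  unfolding sum4_def by (intro sum.cong refl sum.swap)

lemma sum4_swap34: "sum4 I (\<lambda>i j k l. g i j l k) = sum4 I g"
  unfolding sum4_def by (intro sum.cong refl sum.swap)

lemma sum4_permute:
  "sum4 I (\<lambda>i j k l. g i k j l) = sum4 I g"
  "sum4 I (\<lambda>i j k l. g i l j k) = sum4 I g"
  "sum4 I (\<lambda>i j k l. g j k i l) = sum4 I g"
  "sum4 I (\<lambda>i j k l. g j l i k) = sum4 I g"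
  "sum4 I (\<lambda>i j k l. g k l i j) = sum4 I g"
proof -
  show swap23: "sum4 I (\<lambda>i j k l. g i k j l) = sum4 I g" by (rule sum4_swap23)
  show cycle: "sum4 I (\<lambda>i j k l. g i l j k) = sum4 I g"
    using sum4_swap34[of I "\<lambda>i j k l. g i k j l"] swap23 by simp
  show "sum4 I (\<lambda>i j k l. g j k i l) = sum4 I g"
    using sum4_swap12[of I "\<lambda>i j k l. g i k j l"] swap23 by simp
  show "sum4 I (\<lambda>i j k l. g j l i k) = sum4 I g"
    using sum4_swap12[of I "\<lambda>i j k l. g i l j k"] cycle by simp
  then show "sum4 I (\<lambda>i j k l. g k l i j) = sum4 I g"
    using sum4_swap23[of I "\<lambda>i j k l. g j l i k"] by simp
qed

lemma sum4_add: "sum4 I (\<lambda>i j k l. f i j k l + g i j k l) = sum4 I f + sum4 I g"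
  by (simp add: sum4_def sum.distrib)

lemma sum4_mult: "sum4 I (\<lambda>i j k l. c * f i j k l) = c * sum4 I f"
  by (simp add: sum4_def sum_distrib_left)

lemma sum4_mono:
  "(\<And>i j k l. \<lbrakk>i \<in> I; j \<in> I; k \<in> I; l \<in> I\<rbrakk> \<Longrightarrow> f i j k l \<le> g i j k l) \<Longrightarrow> sum4 I f \<le> sum4 I g"
  unfolding sum4_def by (intro sum_mono) auto

lemma sum4_const: "sum4 I (\<lambda>i j k l. c) = c * real (card I) ^ 4"
  by (simp add: sum4_def power4_eq_xxxx)

lemma sum4_prod: "sum4 I (\<lambda>i j k l. f i * f j * f k * f l) = (\<Sum>i\<in>I. f i) ^ 4"
  by (simp add: sum4_def power4_eq_xxxx sum_distrib_left sum_distrib_right mult_ac)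

definition over_pairs :: "('a \<Rightarrow> 'a \<Rightarrow> 'a \<Rightarrow> 'a \<Rightarrow> real) \<Rightarrow> 'a \<Rightarrow> 'a \<Rightarrow> 'a \<Rightarrow> 'a \<Rightarrow> real" where
  "over_pairs g i j k l = g i j k l + g i k j l + g i l j k + g j k i l + g j l i k + g k l i j"

lemma sum4_over_pairs: "sum4 I (over_pairs g) = 6 * sum4 I g"
  unfolding over_pairs_def sum4_add sum4_permute[of I g] by simp

lemma sum4_equal:
  assumes "finite I"
  shows "sum4 I (\<lambda>i j k l. of_bool (i = j)) = real (card I) ^ 3"
proof -
  have "(\<Sum>j\<in>I. of_bool (i = j)) = (1 :: real)" if "i \<in> I" for i
    using assms that by (simp add: of_bool_def)
  then show ?thesis by (simp add: sum4_def power3_eq_cube flip: sum_distrib_left)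
qed

text \<open>For the chirotope of four vectors this means that the cone spanned by the first two meets the
  cone spanned by the last two.\<close>

definition crossing_signs :: "('a \<Rightarrow> 'a \<Rightarrow> 'a \<Rightarrow> real) \<Rightarrow> 'a \<Rightarrow> 'a \<Rightarrow> 'a \<Rightarrow> 'a \<Rightarrow> bool" where
  "crossing_signs \<tau> i j k l \<longleftrightarrow>
    \<tau> j k l \<noteq> 0 \<and> \<tau> i k l = - \<tau> j k l \<and> \<tau> i j l = - \<tau> j k l \<and> \<tau> i j k = \<tau> j k l"

context colored_points
begin

definition chirotope :: "'a \<Rightarrow> 'a \<Rightarrow> 'a \<Rightarrow> real" where
  "chirotope i j k = \<sigma> i * \<sigma> j * \<sigma> k * sgn (orient x y i j k)"

definition net_count :: "'a \<Rightarrow> 'a \<Rightarrow> real" where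
  "net_count i j = (\<Sum>k\<in>I. chirotope i j k)"

lemma abs_color: "i \<in> I \<Longrightarrow> \<bar>\<sigma> i\<bar> = 1"
  using color[of i] by auto

lemma abs_chirotope_le:
  assumes "i \<in> I" "j \<in> I" "k \<in> I"
  shows "\<bar>chirotope i j k\<bar> \<le> 1"
  using assms by (simp add: chirotope_def abs_mult abs_color abs_sgn_eq)

lemma abs_net_count_le:
  assumes "i \<in> I" "j \<in> I"
  shows "\<bar>net_count i j\<bar> \<le> real (card I)"
proof -
  have "\<bar>net_count i j\<bar> \<le> (\<Sum>k\<in>I. \<bar>chirotope i j k\<bar>)" unfolding net_count_def by (rule sum_abs)
  also have "\<dots> \<le> (\<Sum>k\<in>I. 1)" using assms by (intro sum_mono abs_chirotope_le)
  finally show ?thesis by simp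
qed

lemma side_count_add:
  assumes "i \<in> I" "j \<in> I" "i \<noteq> j"
  shows "side_count x y \<sigma> I i j + side_count x y \<sigma> I j i = card I - 2"
proof -
  have "\<sigma> k * orient x y i j k \<noteq> 0" if "k \<in> I - {i, j}" for k
    using color[of k] orient_nonzero[of i j k] that assms by auto
  then have "\<sigma> k * orient x y i j k > 0 \<or> \<sigma> k * orient x y i j k < 0" if "k \<in> I - {i, j}" for k
    using that by (meson linorder_neqE_linordered_idom)
  then have "{k \<in> I. \<sigma> k * orient x y i j k > 0} \<union> {k \<in> I. \<sigma> k * orient x y j i k > 0} = I - {i, j}"
    by (auto simp: orient_swap[of x y j i])
  moreover have "side_count x y \<sigma> I i j + side_count x y \<sigma> I j i
      = card ({k \<in> I. \<sigma> k * orient x y i j k > 0} \<union> {k \<in> I. \<sigma> k * orient x y j i k > 0})"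
    unfolding side_count_def using finite_I
    by (subst card_Un_disjoint) (auto simp: orient_swap[of x y j i])
  ultimately show ?thesis using assms finite_I by (simp add: card_Diff_subset)
qed

lemma net_count_eq:
  assumes "i \<in> I" "j \<in> I"
  shows "net_count i j = \<sigma> i * \<sigma> j * (real (side_count x y \<sigma> I i j) - real (side_count x y \<sigma> I j i))"
proof -
  have "\<sigma> k * sgn (orient x y i j k)
      = of_bool (\<sigma> k * orient x y i j k > 0) - of_bool (\<sigma> k * orient x y j i k > 0)" if "k \<in> I" for k
    using color[OF that] by (auto simp: orient_swap[of x y j i] sgn_if)
  then have "(\<Sum>k\<in>I. \<sigma> k * sgn (orient x y i j k))
      = (\<Sum>k\<in>I. of_bool (\<sigma> k * orient x y i j k > 0) - of_bool (\<sigma> k * orient x y j i k > 0))"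
    by (rule sum.cong[OF refl])
  also have "\<dots> = real (side_count x y \<sigma> I i j) - real (side_count x y \<sigma> I j i)"
    using finite_I by (simp add: sum_subtractf side_count_def Int_def)
  finally show ?thesis by (simp add: net_count_def chirotope_def mult.assoc flip: sum_distrib_left)
qed

lemma balanced_cards:
  assumes "(\<Sum>i\<in>I. \<sigma> i) = 0"
  shows "card {i \<in> I. \<sigma> i = 1} = card I div 2" "card {i \<in> I. \<sigma> i = - 1} = card I div 2" "even (card I)"
proof -
  let ?P = "{i \<in> I. \<sigma> i = 1}" and ?N = "{i \<in> I. \<sigma> i = - 1}"
  have partition: "?P \<union> ?N = I" "?P \<inter> ?N = {}" "finite ?P" "finite ?N" using color finite_I by auto
  have "(\<Sum>i\<in>?P \<union> ?N. \<sigma> i) = (\<Sum>i\<in>?P. \<sigma> i) + (\<Sum>i\<in>?N. \<sigma> i)"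
    using partition(2-4) by (intro sum.union_disjoint) auto
  then have "card ?P = card ?N" using assms partition(1) by simp
  moreover have "card ?P + card ?N = card I" using card_Un_disjoint[OF partition(3,4,2)] partition(1) by simp
  ultimately show "card ?P = card I div 2" "card ?N = card I div 2" "even (card I)" by presburger+
qed

lemma abs_net_count_eq:
  assumes "i \<in> I" "j \<in> I"
  shows "\<bar>net_count i j\<bar> = \<bar>real (side_count x y \<sigma> I i j) - real (side_count x y \<sigma> I j i)\<bar>"
  using assms by (simp add: net_count_eq abs_mult abs_color)

lemma double_sum_imbalance:
  assumes "card I = 2 * a + 2"
  shows "2 * (\<Sum>r\<le>2 * a. imbalance x y \<sigma> (a + r) I)
    = (\<Sum>i\<in>I. \<Sum>j\<in>I. (1 + 3 * \<sigma> i * \<sigma> j) * (((net_count i j)\<^sup>2 + 2 * \<bar>net_count i j\<bar>) / 8))"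
proof -
  let ?e = "\<lambda>i j. 1 + 3 * \<sigma> i * \<sigma> j"
  let ?s = "\<lambda>i j. \<Sum>r\<le>2 * a. real (side_count x y \<sigma> I i j - (a + r))"
  have "(\<Sum>r\<le>2 * a. imbalance x y \<sigma> (a + r) I) = (\<Sum>i\<in>I. \<Sum>j\<in>I. ?e i j * ?s i j)"
    unfolding imbalance_def sum_distrib_left
    by (subst sum.swap, intro sum.cong refl, rule sum.swap)
  moreover have "(\<Sum>i\<in>I. \<Sum>j\<in>I. ?e i j * ?s i j) = (\<Sum>i\<in>I. \<Sum>j\<in>I. ?e j i * ?s j i)"
    by (rule sum.swap)
  ultimately have "2 * (\<Sum>r\<le>2 * a. imbalance x y \<sigma> (a + r) I)
      = (\<Sum>i\<in>I. \<Sum>j\<in>I. ?e i j * ?s i j + ?e j i * ?s j i)"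
    by (simp only: sum.distrib mult_2)
  also have "\<dots> = (\<Sum>i\<in>I. \<Sum>j\<in>I. ?e i j * (((net_count i j)\<^sup>2 + 2 * \<bar>net_count i j\<bar>) / 8))"
  proof (intro sum.cong refl)
    fix i j assume ij_in: "i \<in> I" "j \<in> I"
    have "?s i j + ?s j i = ((net_count i j)\<^sup>2 + 2 * \<bar>net_count i j\<bar>) / 8"
    proof (cases "i = j")
      case True
      then show ?thesis using abs_net_count_eq[OF ij_in] by simp
    next
      case False
      then have "side_count x y \<sigma> I i j + side_count x y \<sigma> I j i = 2 * a"
        using side_count_add[OF ij_in] assms by simp
      from sum_truncated_diff_pair[OF this] show ?thesis
        unfolding sum.distrib
        by (simp only: abs_net_count_eq[OF ij_in] flip: power2_abs[of "net_count i j"]) simp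
    qed
    then show "?e i j * ?s i j + ?e j i * ?s j i = ?e i j * (((net_count i j)\<^sup>2 + 2 * \<bar>net_count i j\<bar>) / 8)"
      by (simp only: mult.commute[of "\<sigma> j"] mult.assoc flip: distrib_left)
  qed
  finally show ?thesis .
qed

lemma weighted_net_count_ge:
  assumes balanced: "(\<Sum>i\<in>I. \<sigma> i) = 0"
  shows "(\<Sum>i\<in>I. \<Sum>j\<in>I. (1 + 3 * \<sigma> i * \<sigma> j) * (net_count i j)\<^sup>2) \<ge> - 8 * real (card I) ^ 3"
proof (cases "I = {}")
  case False
  let ?e = "\<lambda>i j. 1 + 3 * \<sigma> i * \<sigma> j"
  define a where "a = card I div 2 - 1"
  have "card I > 0" using False finite_I by (simp add: card_gt_0_iff)
  with balanced_cards[OF balanced] have card_eq: "card I = 2 * a + 2" "card I div 2 = a + 1"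
    by (auto simp: a_def elim!: evenE)
  have "0 \<le> 2 * (\<Sum>r\<le>2 * a. imbalance x y \<sigma> (a + r) I)"
    using balanced_cards[OF balanced] card_eq(2) colored_points_axioms
    by (auto intro!: mult_nonneg_nonneg sum_nonneg imbalance_nonneg)
  also have "\<dots> \<le> (\<Sum>i\<in>I. \<Sum>j\<in>I. ?e i j * (net_count i j)\<^sup>2 / 8 + real (card I))"
    unfolding double_sum_imbalance[OF card_eq(1)]
  proof (intro sum_mono)
    fix i j assume ij_in: "i \<in> I" "j \<in> I"
    have "?e i j * \<bar>net_count i j\<bar> \<le> 4 * real (card I)"
      using color[OF ij_in(1)] color[OF ij_in(2)] abs_net_count_le[OF ij_in] by (intro mult_mono) auto
    then show "?e i j * (((net_count i j)\<^sup>2 + 2 * \<bar>net_count i j\<bar>) / 8)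
        \<le> ?e i j * (net_count i j)\<^sup>2 / 8 + real (card I)"
      by (simp add: field_simps)
  qed
  also have "\<dots> = (\<Sum>i\<in>I. \<Sum>j\<in>I. ?e i j * (net_count i j)\<^sup>2) / 8 + real (card I) ^ 3"
    by (simp add: sum.distrib power3_eq_cube flip: sum_divide_distrib)
  finally show ?thesis by simp
qed simp

lemma chirotope_swap: "chirotope j i k = - chirotope i j k"
  and chirotope_rotate: "chirotope j k i = chirotope i j k"
  by (simp_all add: chirotope_def orient_swap[of x y j i] orient_rotate mult_ac sgn_minus)

definition pair_weight :: "'a \<Rightarrow> 'a \<Rightarrow> 'a \<Rightarrow> 'a \<Rightarrow> real" where
  "pair_weight i j k l = (1 + 3 * \<sigma> i * \<sigma> j) * (chirotope i j k * chirotope i j l)"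

definition crossing :: "'a \<Rightarrow> 'a \<Rightarrow> 'a \<Rightarrow> 'a \<Rightarrow> real" where
  "crossing i j k l = of_bool (crossing_signs chirotope i j k l)"

lemma sum4_pair_weight:
  "sum4 I pair_weight = (\<Sum>i\<in>I. \<Sum>j\<in>I. (1 + 3 * \<sigma> i * \<sigma> j) * (net_count i j)\<^sup>2)"
  by (simp only: pair_weight_def sum4_def net_count_def power2_eq_square sum_product)
    (simp only: sum_distrib_left)

lemma chirotope_sign:
  assumes "i \<in> I" "j \<in> I" "k \<in> I" "i \<noteq> j" "j \<noteq> k" "i \<noteq> k"
  shows "chirotope i j k = 1 \<or> chirotope i j k = - 1"
proof -
  have "\<bar>chirotope i j k\<bar> = 1"
    using assms orient_nonzero[OF assms] by (simp add: chirotope_def abs_mult abs_color abs_sgn_eq)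
  then show ?thesis by linarith
qed

lemma chirotope_not_alternating:
  assumes in_I: "i \<in> I" "j \<in> I" "k \<in> I" "l \<in> I" and "j \<noteq> k" "k \<noteq> l" "j \<noteq> l"
  shows "\<not> (\<sigma> j * chirotope i k l = - (\<sigma> i * chirotope j k l)
    \<and> \<sigma> k * chirotope i j l = \<sigma> i * chirotope j k l
    \<and> \<sigma> l * chirotope i j k = - (\<sigma> i * chirotope j k l))"
proof -
  let ?p = "\<sigma> i * \<sigma> j * \<sigma> k * \<sigma> l"
  have "\<sigma> i * chirotope j k l = ?p * sgn (orient x y j k l)"
    "\<sigma> j * chirotope i k l = ?p * sgn (orient x y i k l)"
    "\<sigma> k * chirotope i j l = ?p * sgn (orient x y i j l)"
    "\<sigma> l * chirotope i j k = ?p * sgn (orient x y i j k)"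
    unfolding chirotope_def by simp_all
  moreover have "?p \<noteq> 0" using in_I[THEN abs_color] by auto
  moreover have "\<not> (sgn (orient x y i k l) = - sgn (orient x y j k l)
      \<and> sgn (orient x y i j l) = sgn (orient x y j k l)
      \<and> sgn (orient x y i j k) = - sgn (orient x y j k l))"
    using alternating_sum_nonzero orient_four[of x y j k l i] orient_nonzero[of j k l] assms by blast
  ultimately show ?thesis by (simp only: mult_minus_right[symmetric] mult_cancel_left simp_thms)
qed

lemma over_pairs_pair_weight_distinct:
  assumes in_I: "i \<in> I" "j \<in> I" "k \<in> I" "l \<in> I" and "distinct [i, j, k, l]"
  shows "over_pairs pair_weight i j k l = 4 * over_pairs crossing i j k l - 3 + 3 * (\<sigma> i * \<sigma> j * \<sigma> k * \<sigma> l)"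
proof -
  define A B C D where "A = chirotope j k l" and "B = chirotope i k l"
    and "C = chirotope i j l" and "D = chirotope i j k"
  note defs = A_def[symmetric] B_def[symmetric] C_def[symmetric] D_def[symmetric]
  have permuted:
    "chirotope j l k = - A" "chirotope k j l = - A" "chirotope k l j = A" "chirotope l j k = A"
    "chirotope i l k = - B" "chirotope k i l = - B" "chirotope k l i = B" "chirotope l i k = B"
    "chirotope i l j = - C" "chirotope j i l = - C" "chirotope j l i = C" "chirotope l i j = C"
    "chirotope i k j = - D" "chirotope j i k = - D" "chirotope j k i = D" "chirotope k i j = D"
    unfolding A_def B_def C_def D_def by (metis chirotope_swap chirotope_rotate)+
  have signs: "A = 1 \<or> A = - 1" "B = 1 \<or> B = - 1" "C = 1 \<or> C = - 1" "D = 1 \<or> D = - 1"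
    unfolding A_def B_def C_def D_def using assms chirotope_sign by simp_all
  have "over_pairs crossing i j k l = 2 * (of_bool (B = - A \<and> C = - A \<and> D = A)
      + of_bool (B = A \<and> C = A \<and> D = A) + of_bool (B = A \<and> C = - A \<and> D = - A))"
    using signs unfolding over_pairs_def crossing_def crossing_signs_def permuted defs
    by (elim disjE; simp)
  moreover have "\<not> (\<sigma> j * B = - (\<sigma> i * A) \<and> \<sigma> k * C = \<sigma> i * A \<and> \<sigma> l * D = - (\<sigma> i * A))"
    using chirotope_not_alternating[of i j k l] assms by (simp add: defs)
  note six_pairs_identity[OF color color color color signs this, OF in_I]
  ultimately show ?thesis unfolding over_pairs_def[of pair_weight] pair_weight_def permuted defs by simp
qed

lemma over_pairs_pair_weight_le:
  assumes "i \<in> I" "j \<in> I" "k \<in> I" "l \<in> I"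
  shows "over_pairs pair_weight i j k l \<le> 24"
proof -
  have "pair_weight a b c d \<le> 4" if "a \<in> I" "b \<in> I" "c \<in> I" "d \<in> I" for a b c d
  proof -
    have "\<bar>1 + 3 * \<sigma> a * \<sigma> b\<bar> \<le> 4" using color[OF that(1)] color[OF that(2)] by auto
    moreover have "\<bar>chirotope a b c * chirotope a b d\<bar> \<le> 1"
      using abs_chirotope_le[of a b c] abs_chirotope_le[of a b d] that by (simp add: abs_mult mult_le_one)
    ultimately have "\<bar>1 + 3 * \<sigma> a * \<sigma> b\<bar> * \<bar>chirotope a b c * chirotope a b d\<bar> \<le> 4 * 1"
      by (intro mult_mono) auto
    then show ?thesis unfolding pair_weight_def abs_mult[symmetric] by simp
  qed
  then have "over_pairs pair_weight i j k l \<le> 4 + 4 + 4 + 4 + 4 + 4"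
    unfolding over_pairs_def using assms by (intro add_mono) auto
  then show ?thesis by simp
qed

lemma over_pairs_pair_weight_le_crossings:
  assumes "i \<in> I" "j \<in> I" "k \<in> I" "l \<in> I"
  shows "over_pairs pair_weight i j k l
    \<le> 4 * over_pairs crossing i j k l + - 3 + 3 * (\<sigma> i * \<sigma> j * \<sigma> k * \<sigma> l)
      + 30 * over_pairs (\<lambda>i j k l. of_bool (i = j)) i j k l"
proof (cases "distinct [i, j, k, l]")
  case True
  then show ?thesis
    using over_pairs_pair_weight_distinct[OF assms True] by (simp add: over_pairs_def)
next
  case False
  have "\<bar>\<sigma> i * \<sigma> j * \<sigma> k * \<sigma> l\<bar> = 1" using assms by (simp add: abs_mult abs_color)
  moreover have "over_pairs crossing i j k l \<ge> 0" by (simp add: over_pairs_def crossing_def)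
  moreover have "over_pairs (\<lambda>i j k l. of_bool (i = j)) i j k l \<ge> 1"
    using False by (auto simp: over_pairs_def)
  ultimately show ?thesis using over_pairs_pair_weight_le[OF assms] by linarith
qed

lemma crossing_signs_count:
  assumes balanced: "(\<Sum>i\<in>I. \<sigma> i) = 0"
  shows "sum4 I crossing \<ge> real (card I) ^ 4 / 8 - 10 * real (card I) ^ 3"
proof -
  have "- 48 * real (card I) ^ 3 \<le> sum4 I (over_pairs pair_weight)"
    using weighted_net_count_ge[OF balanced] by (simp add: sum4_over_pairs sum4_pair_weight)
  also have "\<dots> \<le> sum4 I (\<lambda>i j k l. 4 * over_pairs crossing i j k l + - 3 + 3 * (\<sigma> i * \<sigma> j * \<sigma> k * \<sigma> l)
      + 30 * over_pairs (\<lambda>i j k l. of_bool (i = j)) i j k l)"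
    by (intro sum4_mono over_pairs_pair_weight_le_crossings)
  also have "\<dots> = 24 * sum4 I crossing - 3 * real (card I) ^ 4 + 180 * real (card I) ^ 3"
    unfolding sum4_add sum4_mult sum4_const sum4_prod balanced
    by (simp add: sum4_over_pairs sum4_equal[OF finite_I])
  finally have "24 * sum4 I crossing \<ge> 3 * real (card I) ^ 4 - 228 * real (card I) ^ 3" by simp
  moreover have "real (card I) ^ 3 \<ge> 0" by simp
  ultimately show ?thesis by linarith
qed

end

section \<open>Vectors in general position\<close>

lemma between_finite_sets:
  fixes S T :: "'a :: unbounded_dense_linorder set"
  assumes "finite S" "finite T" "\<And>s t. \<lbrakk>s \<in> S; t \<in> T\<rbrakk> \<Longrightarrow> s < t"
  obtains c where "\<And>s. s \<in> S \<Longrightarrow> s < c" "\<And>t. t \<in> T \<Longrightarrow> c < t"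
proof -
  obtain b where b_less: "\<And>t. t \<in> T \<Longrightarrow> b < t"
    using assms(2) by (metis Min_le less_le_trans lt_ex)
  define S' where "S' = insert b S"
  have S'_less: "Max S' < t" if "t \<in> T" for t using assms b_less that by (auto simp: S'_def)
  obtain c where c_between: "Max S' < c" "\<And>t. t \<in> T \<Longrightarrow> c < t"
  proof (cases "T = {}")
    case True
    then show thesis using that gt_ex[of "Max S'"] by blast
  next
    case False
    then obtain c where "Max S' < c" "c < Min T" using dense S'_less assms(2) by (meson Min_in)
    then show thesis using that False assms(2) by simp
  qed
  moreover have "s < c" if "s \<in> S" for s
    using c_between(1) Max_ge[of S' s] assms(1) that by (auto simp: S'_def)
  ultimately show thesis using that by blast
qed

lemma halving_prefix:
  fixes rk :: "'a \<Rightarrow> nat"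
  assumes fin: "finite I" and card: "card I = 2 * q" and bij_rk: "bij_betw rk I {..<2 * q}"
  obtains m where "card {i \<in> I. rk i < m \<longleftrightarrow> Q i} = q"
proof -
  define A where "A m = {i \<in> I. rk i < m \<longleftrightarrow> Q i}" for m
  define U where "U m = int (card (A m))" for m
  have finA: "finite (A m)" for m using fin by (simp add: A_def)
  have step: "\<bar>U (Suc m) - U m\<bar> \<le> 1" for m
  proof -
    let ?D = "{i \<in> I. rk i = m}"
    have "card ?D \<le> 1"
      using bij_rk fin by (auto simp: card_le_Suc0_iff_eq bij_betw_def inj_on_def)
    moreover have "card (A (Suc m)) \<le> card (A m \<union> ?D)"
      using fin finA by (intro card_mono) (auto simp: A_def less_Suc_eq)
    moreover have "card (A m) \<le> card (A (Suc m) \<union> ?D)"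
      using fin finA by (intro card_mono) (auto simp: A_def less_Suc_eq)
    ultimately show ?thesis
      using card_Un_le[of "A m" ?D] card_Un_le[of "A (Suc m)" ?D] by (simp add: U_def)
  qed
  have "rk i < 2 * q" if "i \<in> I" for i using bij_rk that by (auto simp: bij_betw_def)
  then have "A 0 \<union> A (2 * q) = I" "A 0 \<inter> A (2 * q) = {}" by (auto simp: A_def)
  then have "U 0 + U (2 * q) = 2 * int q"
    using card_Un_disjoint[OF finA finA, of 0 "2 * q"] card by (simp add: U_def)
  then have "\<exists>m. U m = int q"
    using nat0_intermed_int_val[of "2 * q" U "int q"]
      nat0_intermed_int_val[of "2 * q" "\<lambda>m. - U m" "- int q"] step
    by (cases "U 0 \<le> int q") (auto simp: abs_minus_commute)
  then show thesis using that by (auto simp: U_def A_def)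
qed

lemma halving_functional:
  fixes f g :: "'a \<Rightarrow> real"
  assumes fin: "finite I" and card: "card I = 2 * q" and nonzero: "\<And>i. i \<in> I \<Longrightarrow> g i \<noteq> 0"
    and nonparallel: "\<And>i j. \<lbrakk>i \<in> I; j \<in> I; i \<noteq> j\<rbrakk> \<Longrightarrow> f i * g j \<noteq> f j * g i"
  obtains c where "\<And>i. i \<in> I \<Longrightarrow> c * g i - f i \<noteq> 0" "card {i \<in> I. c * g i - f i > 0} = q"
proof -
  define r where "r i = f i / g i" for i
  have r_neq: "r i \<noteq> r j" if "i \<in> I" "j \<in> I" "i \<noteq> j" for i j
    using nonparallel[OF that] nonzero that by (simp add: r_def frac_eq_eq)
  interpret strict_linorder_on I "\<lambda>i j. r i < r j"
    by unfold_locales (use r_neq in \<open>auto simp: transp_on_def irreflp_on_def totalp_on_def neq_iff\<close>)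
  define rk where "rk = rank_wrt (\<lambda>i j. r i < r j) I"
  have rk_less_iff: "rk i < rk j \<longleftrightarrow> r i < r j" if "i \<in> I" "j \<in> I" for i j
    unfolding rk_def using fin that by (intro rank_less_iff) auto
  have "bij_betw rk I {..<2 * q}" using bij_betw_rank[OF fin subset_refl] card by (simp add: rk_def)
  then obtain m where half: "card {i \<in> I. rk i < m \<longleftrightarrow> g i > 0} = q"
    by (rule halving_prefix[OF fin card])
  have separated: "s < t" if st_in: "s \<in> r ` {i \<in> I. rk i < m}" "t \<in> r ` {i \<in> I. \<not> rk i < m}" for s t
  proof -
    obtain i j where "i \<in> I" "s = r i" "rk i < m" "j \<in> I" "t = r j" "\<not> rk j < m" using st_in by auto
    then show ?thesis using rk_less_iff[of i j] by simp
  qed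
  have "finite (r ` {i \<in> I. rk i < m})" "finite (r ` {i \<in> I. \<not> rk i < m})" using fin by simp_all
  then obtain c where c_between: "\<And>s. s \<in> r ` {i \<in> I. rk i < m} \<Longrightarrow> s < c"
    "\<And>s. s \<in> r ` {i \<in> I. \<not> rk i < m} \<Longrightarrow> c < s"
    using between_finite_sets[OF _ _ separated] by blast
  have factored: "c * g i - f i = g i * (c - r i)" if "i \<in> I" for i
    using nonzero[OF that] by (simp add: r_def field_simps)
  have side: "if rk i < m then r i < c else c < r i" if "i \<in> I" for i using c_between that by auto
  have sign: "c * g i - f i \<noteq> 0 \<and> (c * g i - f i > 0 \<longleftrightarrow> (rk i < m \<longleftrightarrow> g i > 0))" if "i \<in> I" for i
    using side[OF that] nonzero[OF that] unfolding factored[OF that]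
    by (auto simp: zero_less_mult_iff split: if_splits)
  then have "{i \<in> I. c * g i - f i > 0} = {i \<in> I. rk i < m \<longleftrightarrow> g i > 0}" by blast
  then show thesis using that[of c] sign half by simp
qed

definition det3 :: "real ^ 3 \<Rightarrow> real ^ 3 \<Rightarrow> real ^ 3 \<Rightarrow> real" where
  "det3 u v w = det (vector [u, v, w] :: real ^ 3 ^ 3)"

lemma det3_expand:
  "det3 u v w = u $ 1 * (v $ 2 * w $ 3 - w $ 2 * v $ 3) - u $ 2 * (v $ 1 * w $ 3 - w $ 1 * v $ 3)
    + u $ 3 * (v $ 1 * w $ 2 - w $ 1 * v $ 2)"
  by (simp add: det3_def det_3 algebra_simps)

lemma det3_same [simp]: "det3 u u v = 0" "det3 u v u = 0" "det3 u v v = 0"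
  by (simp_all add: det3_expand algebra_simps)

lemma det3_dependency:
  "det3 b c d *\<^sub>R a - det3 a c d *\<^sub>R b + det3 a b d *\<^sub>R c - det3 a b c *\<^sub>R d = 0"
  unfolding vec_eq_iff forall_3 det3_expand by (simp; algebra)

abbreviation det3_sign :: "('a \<Rightarrow> real ^ 3) \<Rightarrow> 'a \<Rightarrow> 'a \<Rightarrow> 'a \<Rightarrow> real" where
  "det3_sign a i j k \<equiv> sgn (det3 (a i) (a j) (a k))"

lemma crossing_signs_imp_cones_meet:
  assumes "crossing_signs (det3_sign a) i j k l"
  obtains c1 c2 c3 c4 where "c1 > 0" "c2 > 0" "c3 > 0" "c4 > 0"
    "c1 *\<^sub>R a i + c2 *\<^sub>R a j = c3 *\<^sub>R a k + c4 *\<^sub>R a l"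
proof -
  define s where "s = det3_sign a j k l"
  have signs: "s \<noteq> 0" "det3_sign a i k l = - s" "det3_sign a i j l = - s" "det3_sign a i j k = s"
    using assms by (auto simp: crossing_signs_def s_def)
  show thesis
  proof (rule that)
    show "s * det3 (a j) (a k) (a l) > 0" "- s * det3 (a i) (a k) (a l) > 0"
      "- s * det3 (a i) (a j) (a l) > 0" "s * det3 (a i) (a j) (a k) > 0"
      using signs by (auto simp: s_def sgn_if split: if_splits)
    show "(s * det3 (a j) (a k) (a l)) *\<^sub>R a i + (- s * det3 (a i) (a k) (a l)) *\<^sub>R a j
        = (- s * det3 (a i) (a j) (a l)) *\<^sub>R a k + (s * det3 (a i) (a j) (a k)) *\<^sub>R a l"
      using arg_cong[OF det3_dependency[of "a j" "a k" "a l" "a i"], of "\<lambda>u. s *\<^sub>R u"]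
      by (simp add: algebra_simps)
  qed
qed

lemma crossing_signs_imp_distinct:
  assumes "crossing_signs (det3_sign a) i j k l"
  shows "distinct [i, j, k, l]"
  using assms unfolding crossing_signs_def by (auto simp: sgn_0_0)

definition general_position :: "'a set \<Rightarrow> ('a \<Rightarrow> real ^ 3) \<Rightarrow> bool" where
  "general_position I a \<longleftrightarrow> (\<forall>i\<in>I. a i $ 1 \<noteq> 0)
    \<and> (\<forall>i\<in>I. \<forall>j\<in>I. i \<noteq> j \<longrightarrow> a i $ 2 * a j $ 1 \<noteq> a j $ 2 * a i $ 1)
    \<and> (\<forall>i\<in>I. \<forall>j\<in>I. \<forall>k\<in>I. i \<noteq> j \<and> j \<noteq> k \<and> i \<noteq> k \<longrightarrow> det3 (a i) (a j) (a k) \<noteq> 0)"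

lemma general_positionD:
  assumes "general_position I a" "i \<in> I"
  shows "a i $ 1 \<noteq> 0"
    and "\<lbrakk>j \<in> I; i \<noteq> j\<rbrakk> \<Longrightarrow> a i $ 2 * a j $ 1 \<noteq> a j $ 2 * a i $ 1"
    and "\<lbrakk>j \<in> I; k \<in> I; i \<noteq> j; j \<noteq> k; i \<noteq> k\<rbrakk> \<Longrightarrow> det3 (a i) (a j) (a k) \<noteq> 0"
  using assms by (auto simp: general_position_def)

definition plane_side :: "real \<Rightarrow> real ^ 3 \<Rightarrow> real" where
  "plane_side c u = c * u $ 1 - u $ 2"

definition proj_x :: "real \<Rightarrow> real ^ 3 \<Rightarrow> real" where
  "proj_x c u = u $ 1 / plane_side c u"

definition proj_y :: "real \<Rightarrow> real ^ 3 \<Rightarrow> real" where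
  "proj_y c u = u $ 3 / plane_side c u"

lemma halving_plane:
  assumes fin: "finite I" and even: "even (card I)" and generic: "general_position I a"
  obtains c where "\<And>i. i \<in> I \<Longrightarrow> plane_side c (a i) \<noteq> 0" "(\<Sum>i\<in>I. sgn (plane_side c (a i))) = 0"
proof -
  obtain q where card: "card I = 2 * q" using even by blast
  obtain c where nonzero: "\<And>i. i \<in> I \<Longrightarrow> plane_side c (a i) \<noteq> 0"
    and half: "card {i \<in> I. plane_side c (a i) > 0} = q"
    using halving_functional[where f = "\<lambda>i. a i $ 2" and g = "\<lambda>i. a i $ 1", OF fin card
        general_positionD(1,2)[OF generic]]
    unfolding plane_side_def by blast
  have "(\<Sum>i\<in>I. sgn (plane_side c (a i))) = (\<Sum>i\<in>I. 2 * of_bool (plane_side c (a i) > 0) - 1)"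
    using nonzero by (intro sum.cong) (auto simp: sgn_if)
  also have "\<dots> = 2 * real (card {i \<in> I. plane_side c (a i) > 0}) - real (card I)"
    using fin by (simp add: sum_subtractf Int_def flip: sum_distrib_left)
  finally show thesis using that[of c] nonzero half card by simp
qed

lemma det3_eq_orient:
  assumes "plane_side c (a i) \<noteq> 0" "plane_side c (a j) \<noteq> 0" "plane_side c (a k) \<noteq> 0"
  shows "det3 (a i) (a j) (a k) = plane_side c (a i) * plane_side c (a j) * plane_side c (a k)
    * orient (\<lambda>i. proj_x c (a i)) (\<lambda>i. proj_y c (a i)) i j k"
proof -
  have coords: "u $ 1 = plane_side c u * proj_x c u" "u $ 3 = plane_side c u * proj_y c u"
    "u $ 2 = c * (plane_side c u * proj_x c u) - plane_side c u"
    if "plane_side c u \<noteq> 0" for u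
    using that by (auto simp: proj_x_def proj_y_def) (simp add: plane_side_def)
  show ?thesis
    unfolding det3_expand orient_def coords[OF assms(1)] coords[OF assms(2)] coords[OF assms(3)]
    by (simp add: algebra_simps)
qed

lemma colored_points_proj:
  assumes fin: "finite I" and generic: "general_position I a"
    and nonzero: "\<And>i. i \<in> I \<Longrightarrow> plane_side c (a i) \<noteq> 0"
  shows "colored_points (\<lambda>i. proj_x c (a i)) (\<lambda>i. proj_y c (a i)) (\<lambda>i. sgn (plane_side c (a i))) I"
proof
  show "sgn (plane_side c (a i)) = 1 \<or> sgn (plane_side c (a i)) = - 1" if "i \<in> I" for i
    using nonzero[OF that] by (auto simp: sgn_if)
  show "inj_on (\<lambda>i. proj_x c (a i)) I"
  proof (rule inj_onI, rule ccontr)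
    fix i j assume ij_in: "i \<in> I" "j \<in> I" "proj_x c (a i) = proj_x c (a j)" "i \<noteq> j"
    then have "a i $ 1 * plane_side c (a j) = a j $ 1 * plane_side c (a i)"
      using nonzero by (simp add: proj_x_def frac_eq_eq)
    then have "a i $ 2 * a j $ 1 = a j $ 2 * a i $ 1" by (simp add: plane_side_def algebra_simps)
    then show False using general_positionD(2)[OF generic] ij_in by blast
  qed
  show "orient (\<lambda>i. proj_x c (a i)) (\<lambda>i. proj_y c (a i)) i j k \<noteq> 0"
    if "i \<in> I" "j \<in> I" "k \<in> I" "i \<noteq> j" "j \<noteq> k" "i \<noteq> k" for i j k
    using general_positionD(3)[OF generic that] det3_eq_orient[of c a i j k] nonzero that by simp
qed fact

lemma general_position_crossing_count:
  assumes fin: "finite I" and even: "even (card I)" and generic: "general_position I a"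
  shows "sum4 I (\<lambda>i j k l. of_bool (crossing_signs (det3_sign a) i j k l))
    \<ge> real (card I) ^ 4 / 8 - 10 * real (card I) ^ 3"
proof -
  obtain c where nonzero: "\<And>i. i \<in> I \<Longrightarrow> plane_side c (a i) \<noteq> 0"
    and balanced: "(\<Sum>i\<in>I. sgn (plane_side c (a i))) = 0"
    using halving_plane[OF assms] by blast
  interpret C: colored_points "\<lambda>i. proj_x c (a i)" "\<lambda>i. proj_y c (a i)" "\<lambda>i. sgn (plane_side c (a i))" I
    using fin generic nonzero by (rule colored_points_proj)
  have "C.chirotope i j k = det3_sign a i j k" if "i \<in> I" "j \<in> I" "k \<in> I" for i j k
    using det3_eq_orient[of c a i j k] nonzero that by (simp add: C.chirotope_def sgn_mult)
  then have "sum4 I C.crossing = sum4 I (\<lambda>i j k l. of_bool (crossing_signs (det3_sign a) i j k l))"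
    unfolding sum4_def C.crossing_def crossing_signs_def by (intro sum.cong refl) simp
  then show ?thesis using C.crossing_signs_count balanced by simp
qed

section \<open>Geodesic arcs\<close>

definition orthonormal :: "'a :: real_inner \<Rightarrow> 'a \<Rightarrow> bool" where
  "orthonormal x w \<longleftrightarrow> norm x = 1 \<and> norm w = 1 \<and> x \<bullet> w = 0"

definition circle_point :: "'a :: real_inner \<Rightarrow> 'a \<Rightarrow> real \<Rightarrow> 'a" where
  "circle_point x w s = cos s *\<^sub>R x + sin s *\<^sub>R w"

definition circle_arc :: "'a :: real_inner \<Rightarrow> 'a \<Rightarrow> real \<Rightarrow> 'a set" where
  "circle_arc x w \<theta> = circle_point x w ` {0..\<theta>}"

lemma circle_point_0 [simp]: "circle_point x w 0 = x"
  and circle_point_pi [simp]: "circle_point x w pi = - x"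
  by (simp_all add: circle_point_def)

lemma circle_point_uminus: "circle_point x (- w) s = circle_point x w (- s)"
  by (simp add: circle_point_def)

lemma circle_point_add:
  "circle_point (circle_point x w s) (circle_point x w (s + pi / 2)) r = circle_point x w (s + r)"
  by (simp add: circle_point_def cos_add sin_add algebra_simps)

lemma inner_combination_orthonormal:
  assumes "orthonormal x w"
  shows "(c *\<^sub>R x + d *\<^sub>R w) \<bullet> (c' *\<^sub>R x + d' *\<^sub>R w) = c * c' + d * d'"
proof -
  have "x \<bullet> x = 1" "w \<bullet> w = 1" "x \<bullet> w = 0" "w \<bullet> x = 0"
    using assms by (simp_all add: orthonormal_def dot_square_norm inner_commute[of w])
  then show ?thesis by (simp add: inner_add_left inner_add_right)
qed

lemma inner_circle_point: "orthonormal x w \<Longrightarrow> circle_point x w s \<bullet> circle_point x w t = cos (s - t)"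
  by (simp add: circle_point_def inner_combination_orthonormal cos_diff)

lemma norm_circle_point [simp]: "orthonormal x w \<Longrightarrow> norm (circle_point x w s) = 1"
  by (simp add: norm_eq_1 inner_circle_point)

lemma orthonormal_uminus: "orthonormal x w \<Longrightarrow> orthonormal x (- w)"
  by (simp add: orthonormal_def)

lemma orthonormal_rotate:
  "orthonormal x w \<Longrightarrow> orthonormal (circle_point x w s) (circle_point x w (s + pi / 2))"
  by (simp add: orthonormal_def[of "circle_point x w s"] inner_circle_point)

lemma circle_point_eq_imp:
  assumes "orthonormal x w" "circle_point x w s = circle_point x w t" "\<bar>s - t\<bar> \<le> pi"
  shows "s = t"
proof -
  have "cos \<bar>s - t\<bar> = circle_point x w s \<bullet> circle_point x w t"
    by (simp add: inner_circle_point assms(1))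
  also have "\<dots> = cos 0" using inner_circle_point[OF assms(1), of t t] assms(2) by simp
  finally show ?thesis using cos_inj_pi[of "\<bar>s - t\<bar>" 0] assms(3) by simp
qed

lemma circle_points_eq_imp_direction_eq:
  assumes orth: "orthonormal z \<tau>" "orthonormal z \<tau>'"
    and common: "circle_point z \<tau> s = circle_point z \<tau>' t" and "sin s \<noteq> 0"
  shows "\<tau> = \<tau>' \<or> \<tau> = - \<tau>'"
proof -
  have "z \<bullet> circle_point z \<tau> s = cos s" "z \<bullet> circle_point z \<tau>' t = cos t"
    using inner_circle_point[OF orth(1), of 0 s] inner_circle_point[OF orth(2), of 0 t] by simp_all
  then have "cos s = cos t" using common by simp
  then have scaled: "sin s *\<^sub>R \<tau> = sin t *\<^sub>R \<tau>'" using common by (simp add: circle_point_def)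
  have "norm (sin s *\<^sub>R \<tau>) = norm (sin t *\<^sub>R \<tau>')" by (simp only: scaled)
  then have "sin t = sin s \<or> sin t = - sin s" using orth by (auto simp: orthonormal_def abs_eq_iff)
  then have "sin s *\<^sub>R \<tau> = sin s *\<^sub>R \<tau>' \<or> sin s *\<^sub>R \<tau> = sin s *\<^sub>R (- \<tau>')" using scaled by auto
  then show ?thesis using \<open>sin s \<noteq> 0\<close> by (metis scaleR_left_imp_eq)
qed

lemma nonneg_combination_in_circle_arc:
  assumes orth: "orthonormal x w" and \<theta>: "0 < \<theta>" "\<theta> < pi" and coeffs: "0 \<le> A" "0 \<le> B"
    and unit: "norm (A *\<^sub>R x + B *\<^sub>R circle_point x w \<theta>) = 1"
  shows "A *\<^sub>R x + B *\<^sub>R circle_point x w \<theta> \<in> circle_arc x w \<theta>"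
proof -
  define c where "c = A + B * cos \<theta>"
  define d where "d = B * sin \<theta>"
  have sin: "sin \<theta> > 0" using \<theta> by (intro sin_gt_zero)
  have z_eq: "A *\<^sub>R x + B *\<^sub>R circle_point x w \<theta> = c *\<^sub>R x + d *\<^sub>R w"
    by (simp add: circle_point_def c_def d_def algebra_simps)
  have "c\<^sup>2 + d\<^sup>2 = 1"
    using unit unfolding z_eq norm_eq_1 by (simp add: inner_combination_orthonormal[OF orth] power2_eq_square)
  moreover have "0 \<le> d" using coeffs sin by (simp add: d_def)
  ultimately obtain s where s_angle: "0 \<le> s" "s \<le> pi" "c = cos s" "d = sin s" using sincos_total_pi by blast
  have "s \<le> \<theta>"
  proof (rule ccontr)
    assume "\<not> s \<le> \<theta>"
    then have "0 < sin (s - \<theta>)" using s_angle \<theta> by (intro sin_gt_zero) auto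
    also have "sin (s - \<theta>) = - (A * sin \<theta>)"
      by (simp add: sin_diff c_def d_def algebra_simps flip: s_angle(3,4))
    finally show False using coeffs sin by (simp add: zero_less_mult_iff mult_less_0_iff)
  qed
  then show ?thesis
    using s_angle z_eq by (auto simp: circle_arc_def circle_point_def intro!: image_eqI[of _ _ s])
qed

lemma unit_vectors_eqI:
  fixes x y :: "'a :: real_inner"
  assumes "norm x = 1" "norm y = 1" "x \<bullet> y = 1"
  shows "x = y"
  using norm_cauchy_schwarz_eq[of x y] assms by simp

lemma circle_point_between:
  fixes x y :: "'a :: real_inner"
  assumes "norm x = 1" "norm y = 1" "x \<noteq> y" "x \<noteq> - y"
  obtains w \<theta> where "0 < \<theta>" "\<theta> < pi" "orthonormal x w" "y = circle_point x w \<theta>"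
proof -
  have "\<bar>x \<bullet> y\<bar> \<le> 1" using Cauchy_Schwarz_ineq2[of x y] assms by simp
  moreover have "x \<bullet> y \<noteq> 1" "x \<bullet> y \<noteq> - 1"
    using unit_vectors_eqI[of x y] unit_vectors_eqI[of x "- y"] assms by auto
  ultimately have bounds: "- 1 < x \<bullet> y" "x \<bullet> y < 1" by auto
  define \<theta> where "\<theta> = arccos (x \<bullet> y)"
  have \<theta>: "0 < \<theta>" "\<theta> < pi" "cos \<theta> = x \<bullet> y"
    using bounds arccos_lt_bounded[of "x \<bullet> y"] by (simp_all add: \<theta>_def)
  then have sin: "sin \<theta> > 0" by (intro sin_gt_zero)
  define w where "w = (1 / sin \<theta>) *\<^sub>R (y - cos \<theta> *\<^sub>R x)"
  have inner_self: "x \<bullet> x = 1" "y \<bullet> y = 1" using assms by (simp_all add: dot_square_norm)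
  have "w \<bullet> w = (1 / sin \<theta>)\<^sup>2 * (1 - (cos \<theta>)\<^sup>2)"
    using inner_self \<theta>(3)
    by (simp add: w_def inner_diff_right inner_diff_left inner_commute[of y x] power2_eq_square algebra_simps)
  also have "\<dots> = 1" using sin by (simp add: power_divide sin_squared_eq[symmetric])
  finally have "norm w = 1" by (simp add: norm_eq_1)
  moreover have "x \<bullet> w = 0" using inner_self \<theta>(3) by (simp add: w_def inner_diff_right)
  ultimately have "orthonormal x w" using assms(1) by (simp add: orthonormal_def)
  moreover have "y = circle_point x w \<theta>" using sin by (simp add: circle_point_def w_def)
  ultimately show thesis using that \<theta> by blast
qed

lemma sphere_dist_circle_point:
  assumes "orthonormal x w" "\<bar>s - t\<bar> \<le> pi"
  shows "sphere_dist (circle_point x w s) (circle_point x w t) = \<bar>s - t\<bar>"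
  using assms arccos_cos[of "\<bar>s - t\<bar>"] by (simp add: sphere_dist_def inner_circle_point)

lemma min_geodesic_arc_circle_arc:
  assumes orth: "orthonormal x w" and \<theta>: "0 \<le> \<theta>" "\<theta> \<le> pi"
  shows "min_geodesic_arc x (circle_point x w \<theta>) (circle_arc x w \<theta>)"
proof -
  have "sphere_dist x (circle_point x w \<theta>) = \<theta>"
    using sphere_dist_circle_point[OF orth, of 0 \<theta>] \<theta> by simp
  then show ?thesis
    unfolding min_geodesic_arc_def circle_arc_def using orth \<theta>
    by (intro exI[of _ "circle_point x w"]) (auto intro!: sphere_dist_circle_point)
qed

lemma unit_speed_curve_eq_circle_point:
  fixes g :: "real \<Rightarrow> 'a :: real_inner"
  assumes \<theta>: "0 < \<theta>" "\<theta> \<le> pi"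
    and inner_g: "\<And>s t. \<lbrakk>s \<in> {0..\<theta>}; t \<in> {0..\<theta>}\<rbrakk> \<Longrightarrow> g s \<bullet> g t = cos (s - t)"
  obtains w where "orthonormal (g 0) w" "\<And>s. s \<in> {0..\<theta>} \<Longrightarrow> g s = circle_point (g 0) w s"
proof -
  \<comment> \<open>The end of the curve may be antipodal to \<open>g 0\<close>, so the direction is read off the midpoint.\<close>
  define m where "m = \<theta> / 2"
  have m_bounds: "m \<in> {0..\<theta>}" "0 < m" "m < pi" using \<theta> by (auto simp: m_def)
  then have sin: "sin m > 0" by (intro sin_gt_zero) auto
  define w where "w = (1 / sin m) *\<^sub>R (g m - cos m *\<^sub>R g 0)"
  have inner_0: "g 0 \<bullet> g s = cos s" if "s \<in> {0..\<theta>}" for s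
    using inner_g[of 0 s] that \<theta> by simp
  have inner_w: "g s \<bullet> w = sin s" if s_in: "s \<in> {0..\<theta>}" for s
  proof -
    have "g s \<bullet> w = (cos (s - m) - cos m * cos s) / sin m"
      using inner_g[OF s_in m_bounds(1)] inner_0[OF s_in]
      by (simp add: w_def inner_diff_right inner_commute[of "g s" "g 0"])
    then show ?thesis using sin by (simp add: cos_diff)
  qed
  have "g 0 \<bullet> w = 0" using inner_w[of 0] \<theta> by simp
  moreover have "w \<bullet> w = 1"
    using inner_w[OF m_bounds(1)] sin \<open>g 0 \<bullet> w = 0\<close> by (subst (1) w_def) (simp add: inner_diff_left)
  ultimately have orth: "orthonormal (g 0) w"
    using inner_0[of 0] \<theta> by (simp add: orthonormal_def norm_eq_1)
  moreover have "g s = circle_point (g 0) w s" if s_in: "s \<in> {0..\<theta>}" for s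
  proof (rule unit_vectors_eqI)
    show "norm (g s) = 1" using inner_g[OF s_in s_in] by (simp add: norm_eq_1)
    show "g s \<bullet> circle_point (g 0) w s = 1"
      using inner_0[OF s_in] inner_w[OF s_in]
      by (simp add: circle_point_def inner_add_right inner_commute[of "g s" "g 0"] flip: power2_eq_square)
  qed (use orth in simp)
  ultimately show thesis by (rule that)
qed

lemma min_geodesic_arc_imp_circle_arc:
  assumes arc: "min_geodesic_arc x y A" and unit: "norm x = 1" "norm y = 1" and "x \<noteq> y"
  obtains w \<theta> where "0 < \<theta>" "\<theta> \<le> pi" "orthonormal x w" "y = circle_point x w \<theta>" "A = circle_arc x w \<theta>"
proof -
  define \<theta> where "\<theta> = sphere_dist x y"
  obtain g where geodesic: "g 0 = x" "g \<theta> = y" "g ` {0..\<theta>} \<subseteq> sphere 0 1"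
    "\<And>s t. \<lbrakk>s \<in> {0..\<theta>}; t \<in> {0..\<theta>}\<rbrakk> \<Longrightarrow> sphere_dist (g s) (g t) = \<bar>s - t\<bar>" "A = g ` {0..\<theta>}"
    using arc unfolding min_geodesic_arc_def \<theta>_def by blast
  have inner_le: "\<bar>u \<bullet> v\<bar> \<le> 1" if "norm u = 1" "norm v = 1" for u v :: "real ^ 3"
    using Cauchy_Schwarz_ineq2[of u v] that by simp
  have "\<theta> \<noteq> 0" using geodesic(1,2) \<open>x \<noteq> y\<close> by auto
  then have \<theta>: "0 < \<theta>" "\<theta> \<le> pi"
    using inner_le[OF unit] arccos_lbound[of "x \<bullet> y"] arccos_ubound[of "x \<bullet> y"]
    by (auto simp: \<theta>_def sphere_dist_def abs_le_iff less_le)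
  have "g s \<bullet> g t = cos (s - t)" if "s \<in> {0..\<theta>}" "t \<in> {0..\<theta>}" for s t
  proof -
    have "norm (g s) = 1" "norm (g t) = 1"
      using subsetD[OF geodesic(3) imageI[OF that(1)]] subsetD[OF geodesic(3) imageI[OF that(2)]] by simp_all
    then have "g s \<bullet> g t = cos (sphere_dist (g s) (g t))"
      using inner_le[of "g s" "g t"] by (simp add: sphere_dist_def cos_arccos_abs)
    then show ?thesis by (simp add: geodesic(4)[OF that])
  qed
  from unit_speed_curve_eq_circle_point[OF \<theta> this]
  obtain w where "orthonormal x w" "\<And>s. s \<in> {0..\<theta>} \<Longrightarrow> g s = circle_point x w s"
    unfolding geodesic(1) by blast
  then show thesis using that[of \<theta> w] \<theta> geodesic(2,5) by (auto simp: circle_arc_def)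
qed

lemma min_geodesic_arc_exists:
  assumes "norm x = 1" "norm y = 1" "x \<noteq> y" "x \<noteq> - y"
  shows "\<exists>A. min_geodesic_arc x y A"
  using circle_point_between[OF assms] min_geodesic_arc_circle_arc by (metis less_imp_le)

lemma min_geodesic_arc_commute:
  assumes arc: "min_geodesic_arc x y A" and "norm x = 1" "norm y = 1" "x \<noteq> y"
  shows "min_geodesic_arc y x A"
proof -
  obtain w \<theta> where circle: "0 < \<theta>" "\<theta> \<le> pi" "orthonormal x w" "y = circle_point x w \<theta>" "A = circle_arc x w \<theta>"
    using min_geodesic_arc_imp_circle_arc[OF assms] .
  define w' where "w' = - circle_point x w (\<theta> + pi / 2)"
  have reversed: "circle_point y w' s = circle_point x w (\<theta> - s)" for s
    by (simp add: w'_def circle(4) circle_point_uminus circle_point_add)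
  have "orthonormal y w'"
    unfolding w'_def circle(4) using circle(3) by (intro orthonormal_uminus orthonormal_rotate)
  then have "min_geodesic_arc y (circle_point y w' \<theta>) (circle_arc y w' \<theta>)"
    using circle(1,2) by (intro min_geodesic_arc_circle_arc) auto
  moreover have "circle_arc y w' \<theta> = circle_point x w ` (\<lambda>s. \<theta> - s) ` {0..\<theta>}"
    unfolding circle_arc_def reversed image_image ..
  then have "circle_arc y w' \<theta> = A" by (simp add: circle(5) circle_arc_def)
  ultimately show ?thesis by (simp add: reversed)
qed

section \<open>Drawings of complete graphs\<close>

lemma crossingsI:
  "\<lbrakk>e \<in> E; f \<in> E; e \<noteq> f; x \<in> edge_interior p a e; x \<in> edge_interior p a f\<rbrakk> \<Longrightarrow> ({e, f}, x) \<in> crossings E p a"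
  unfolding crossings_def by blast

lemma crossingsE:
  assumes "c \<in> crossings E p a"
  obtains e f x where "c = ({e, f}, x)" "e \<in> E" "f \<in> E" "e \<noteq> f"
    "x \<in> edge_interior p a e" "x \<in> edge_interior p a f"
  using assms unfolding crossings_def by blast

definition all_edges :: "'v set \<Rightarrow> 'v set set" where
  "all_edges V = {e. e \<subseteq> V \<and> card e = 2}"

lemma complete_edges_eq: "complete_edges n = all_edges {..<n}"
  by (simp add: complete_edges_def all_edges_def)

lemma doubleton_in_all_edges [simp]: "{u, v} \<in> all_edges V \<longleftrightarrow> u \<in> V \<and> v \<in> V \<and> u \<noteq> v"
  by (auto simp: all_edges_def card_insert_if)

lemma all_edges_cases:
  assumes "e \<in> all_edges V"
  obtains u v where "e = {u, v}" "u \<in> V" "v \<in> V" "u \<noteq> v"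
  using assms by (auto simp: all_edges_def card_2_iff)

lemma finite_all_edges [simp]: "finite V \<Longrightarrow> finite (all_edges V)"
  by (simp add: all_edges_def)

lemma card_all_edges: "finite V \<Longrightarrow> card (all_edges V) = card V choose 2"
  by (simp add: all_edges_def n_subsets)

locale complete_drawing =
  fixes V :: "'v set" and p :: "'v \<Rightarrow> real ^ 3" and a :: "'v set \<Rightarrow> (real ^ 3) set"
  assumes finite_V: "finite V" and drawing: "spherical_geodesic_drawing V (all_edges V) p a"
begin

lemma norm_p: "u \<in> V \<Longrightarrow> norm (p u) = 1"
  using drawing unfolding spherical_geodesic_drawing_def by (auto simp: image_subset_iff)

lemma p_eq_imp: "\<lbrakk>p u = p v; u \<in> V; v \<in> V\<rbrakk> \<Longrightarrow> u = v"
  using drawing unfolding spherical_geodesic_drawing_def by (meson inj_onD)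

lemma edge_arc: "\<lbrakk>u \<in> V; v \<in> V; u \<noteq> v\<rbrakk> \<Longrightarrow> min_geodesic_arc (p u) (p v) (a {u, v})"
  using drawing unfolding spherical_geodesic_drawing_def by simp

lemma vertex_not_on_arc: "\<lbrakk>e \<in> all_edges V; x \<in> V; x \<notin> e\<rbrakk> \<Longrightarrow> p x \<notin> a e"
  using drawing unfolding spherical_geodesic_drawing_def by blast

lemma edge_circle_arc:
  assumes "u \<in> V" "v \<in> V" "u \<noteq> v"
  obtains w \<theta> where "0 < \<theta>" "\<theta> \<le> pi" "orthonormal (p u) w" "p v = circle_point (p u) w \<theta>"
    "a {u, v} = circle_arc (p u) w \<theta>"
proof -
  have "p u \<noteq> p v" using p_eq_imp assms by blast
  from min_geodesic_arc_imp_circle_arc[OF edge_arc[OF assms] norm_p norm_p this] that show thesis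
    using assms by metis
qed

definition arc_through :: "'v set \<Rightarrow> real ^ 3 \<Rightarrow> real ^ 3 \<Rightarrow> 'v \<Rightarrow> 'v \<Rightarrow> real \<Rightarrow> real \<Rightarrow> bool" where
  "arc_through e z \<tau> u v \<alpha> \<beta> \<longleftrightarrow> orthonormal z \<tau> \<and> 0 < \<alpha> \<and> 0 < \<beta> \<and> \<alpha> + \<beta> \<le> pi \<and> e = {u, v}
    \<and> p u = circle_point z \<tau> (- \<alpha>) \<and> p v = circle_point z \<tau> \<beta> \<and> a e = circle_point z \<tau> ` {- \<alpha>..\<beta>}"

lemma arc_through_flip:
  assumes "arc_through e z \<tau> u v \<alpha> \<beta>"
  shows "arc_through e z (- \<tau>) v u \<beta> \<alpha>"
proof -
  have "circle_point z (- \<tau>) ` {- \<beta>..\<alpha>} = circle_point z \<tau> ` uminus ` {- \<beta>..\<alpha>}"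
    unfolding image_image by (intro image_cong) (simp_all add: circle_point_uminus)
  then show ?thesis
    using assms by (auto simp: arc_through_def circle_point_uminus orthonormal_uminus)
qed

lemma edge_interior_imp_arc_through:
  assumes e_in: "e \<in> all_edges V" and z_in: "z \<in> edge_interior p a e"
  obtains \<tau> u v \<alpha> \<beta> where "arc_through e z \<tau> u v \<alpha> \<beta>"
proof -
  obtain u v where ends: "e = {u, v}" "u \<in> V" "v \<in> V" "u \<noteq> v" using e_in by (rule all_edges_cases)
  obtain w \<theta> where circle: "0 < \<theta>" "\<theta> \<le> pi" "orthonormal (p u) w" "p v = circle_point (p u) w \<theta>"
    "a {u, v} = circle_arc (p u) w \<theta>" using edge_circle_arc[OF ends(2-4)] .
  have "z \<in> circle_arc (p u) w \<theta>" "z \<noteq> p u" "z \<noteq> p v" using z_in ends circle by (auto simp: edge_interior_def)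
  then obtain s where s_angle: "z = circle_point (p u) w s" "0 < s" "s < \<theta>"
    unfolding circle_arc_def circle(4) using circle_point_0[of "p u" w] by (force simp: less_le)
  define \<tau> where "\<tau> = circle_point (p u) w (s + pi / 2)"
  have shift: "circle_point z \<tau> r = circle_point (p u) w (s + r)" for r
    by (simp add: s_angle(1) \<tau>_def circle_point_add)
  have "circle_point z \<tau> ` {- s..\<theta> - s} = circle_point (p u) w ` (+) s ` {- s..\<theta> - s}"
    unfolding image_image by (intro image_cong) (simp_all add: shift)
  then have "a {u, v} = circle_point z \<tau> ` {- s..\<theta> - s}" by (simp add: circle(5) circle_arc_def)
  moreover have "p u = circle_point z \<tau> (- s)" "p v = circle_point z \<tau> (\<theta> - s)"
    by (simp_all add: shift circle(4))
  moreover have "orthonormal z \<tau>" using circle(3) by (simp add: s_angle(1) \<tau>_def orthonormal_rotate)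
  ultimately have "arc_through e z \<tau> u v s (\<theta> - s)"
    using s_angle(2,3) circle(2) by (simp add: arc_through_def ends(1))
  then show thesis by (rule that)
qed

lemma arc_through_angle_le:
  assumes through_e: "arc_through e z \<tau> u v \<alpha> \<beta>" "e \<in> all_edges V"
    and through_f: "arc_through f z \<tau> u' v' \<alpha>' \<beta>'" "f \<in> all_edges V"
  shows "\<alpha>' \<le> \<alpha>"
proof (rule ccontr)
  assume "\<not> \<alpha>' \<le> \<alpha>"
  note params_e = through_e(1)[unfolded arc_through_def] and params_f = through_f(1)[unfolded arc_through_def]
  have orth: "orthonormal z \<tau>" and p_u: "p u = circle_point z \<tau> (- \<alpha>)" and "u \<in> V"
    using params_e through_e(2) by auto
  have "- \<alpha> \<in> {- \<alpha>'..\<beta>'}" using \<open>\<not> \<alpha>' \<le> \<alpha>\<close> params_e params_f by auto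
  then have "p u \<in> a f" using params_f p_u by blast
  then have "u = u' \<or> u = v'" using vertex_not_on_arc[OF through_f(2) \<open>u \<in> V\<close>] params_f by blast
  then have "circle_point z \<tau> (- \<alpha>) = circle_point z \<tau> (- \<alpha>') \<or> circle_point z \<tau> (- \<alpha>) = circle_point z \<tau> \<beta>'"
    using p_u params_f by auto
  then have "- \<alpha> = - \<alpha>' \<or> - \<alpha> = \<beta>'"
    using circle_point_eq_imp[OF orth, of "- \<alpha>" "- \<alpha>'"] circle_point_eq_imp[OF orth, of "- \<alpha>" \<beta>']
      \<open>\<not> \<alpha>' \<le> \<alpha>\<close> params_e params_f by (auto simp: abs_le_iff)
  then show False using \<open>\<not> \<alpha>' \<le> \<alpha>\<close> params_e params_f by auto
qed

lemma arc_through_same_direction: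
  assumes through_e: "arc_through e z \<tau> u v \<alpha> \<beta>" "e \<in> all_edges V"
    and through_f: "arc_through f z \<tau> u' v' \<alpha>' \<beta>'" "f \<in> all_edges V"
  shows "e = f"
proof -
  note flipped_e = arc_through_flip[OF through_e(1)] and flipped_f = arc_through_flip[OF through_f(1)]
  have "\<alpha> = \<alpha>'"
    using arc_through_angle_le[OF through_e through_f] arc_through_angle_le[OF through_f through_e] by simp
  moreover have "\<beta> = \<beta>'"
    using arc_through_angle_le[OF flipped_e through_e(2) flipped_f through_f(2)]
      arc_through_angle_le[OF flipped_f through_f(2) flipped_e through_e(2)] by simp
  ultimately have "p u = p u'" "p v = p v'" using through_e(1) through_f(1) by (auto simp: arc_through_def)
  then show ?thesis using p_eq_imp through_e through_f by (auto simp: arc_through_def)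
qed

lemma crossing_arcs_imp_sin_eq_0:
  assumes through_e: "arc_through e z \<tau> u v \<alpha> \<beta>" "e \<in> all_edges V"
    and through_f: "arc_through f z \<tau>' u' v' \<alpha>' \<beta>'" "f \<in> all_edges V"
    and "e \<noteq> f" and common: "circle_point z \<tau> s = circle_point z \<tau>' t"
  shows "sin s = 0"
proof (rule ccontr)
  assume "sin s \<noteq> 0"
  moreover have "orthonormal z \<tau>" "orthonormal z \<tau>'"
    using through_e through_f by (simp_all add: arc_through_def)
  ultimately have "\<tau> = \<tau>' \<or> \<tau> = - \<tau>'" using circle_points_eq_imp_direction_eq common by blast
  then show False
    using arc_through_same_direction[OF through_e _ through_f(2)] through_f(1)
      arc_through_flip[OF through_f(1)] \<open>e \<noteq> f\<close> by blast
qed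

lemma crossing_edges_disjoint:
  assumes edges: "e \<in> all_edges V" "f \<in> all_edges V" "e \<noteq> f"
    and z_in: "z \<in> edge_interior p a e" "z \<in> edge_interior p a f"
  shows "e \<inter> f = {}"
proof (rule ccontr)
  obtain \<tau> u v \<alpha> \<beta> where through_e: "arc_through e z \<tau> u v \<alpha> \<beta>"
    using edge_interior_imp_arc_through[OF edges(1) z_in(1)] .
  obtain \<tau>' u' v' \<alpha>' \<beta>' where through_f: "arc_through f z \<tau>' u' v' \<alpha>' \<beta>'"
    using edge_interior_imp_arc_through[OF edges(2) z_in(2)] .
  have ends: "\<exists>s. sin s \<noteq> 0 \<and> p q = circle_point z \<tau> s" if "q \<in> e" for q
  proof -
    have "sin \<alpha> > 0" "sin \<beta> > 0" using through_e by (auto simp: arc_through_def intro!: sin_gt_zero)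
    then have "sin (- \<alpha>) \<noteq> 0" "sin \<beta> \<noteq> 0" by auto
    moreover have "p q = circle_point z \<tau> (- \<alpha>) \<or> p q = circle_point z \<tau> \<beta>"
      using that through_e by (auto simp: arc_through_def)
    ultimately show ?thesis by blast
  qed
  assume "e \<inter> f \<noteq> {}"
  then obtain q where q_in: "q \<in> e" "q \<in> f" by blast
  then obtain s where q_on_e: "sin s \<noteq> 0" "p q = circle_point z \<tau> s" using ends by blast
  obtain t where q_on_f: "p q = circle_point z \<tau>' t" using q_in(2) through_f by (auto simp: arc_through_def)
  have "circle_point z \<tau> s = circle_point z \<tau>' t" using q_on_e(2) q_on_f by simp
  then show False
    using crossing_arcs_imp_sin_eq_0[OF through_e edges(1) through_f edges(2,3)] q_on_e(1) by blast
qed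

lemma common_interior_points:
  assumes edges: "e \<in> all_edges V" "f \<in> all_edges V" "e \<noteq> f"
    and z_in: "z \<in> edge_interior p a e" "z \<in> edge_interior p a f"
    and y_in: "y \<in> edge_interior p a e" "y \<in> edge_interior p a f"
  shows "y = z \<or> y = - z"
proof -
  obtain \<tau> u v \<alpha> \<beta> where through_e: "arc_through e z \<tau> u v \<alpha> \<beta>"
    using edge_interior_imp_arc_through[OF edges(1) z_in(1)] .
  obtain \<tau>' u' v' \<alpha>' \<beta>' where through_f: "arc_through f z \<tau>' u' v' \<alpha>' \<beta>'"
    using edge_interior_imp_arc_through[OF edges(2) z_in(2)] .
  have "a e = circle_point z \<tau> ` {- \<alpha>..\<beta>}" "a f = circle_point z \<tau>' ` {- \<alpha>'..\<beta>'}"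
    using through_e through_f unfolding arc_through_def by blast+
  then have "y \<in> circle_point z \<tau> ` {- \<alpha>..\<beta>}" "y \<in> circle_point z \<tau>' ` {- \<alpha>'..\<beta>'}"
    using y_in by (auto simp: edge_interior_def)
  then obtain s t where y_eq: "y = circle_point z \<tau> s" "y = circle_point z \<tau>' t" by blast
  then have "sin s = 0"
    using crossing_arcs_imp_sin_eq_0[OF through_e edges(1) through_f edges(2,3), of s t] by simp
  then have "cos s = 1 \<or> cos s = - 1" using sin_zero_abs_cos_one[of s] by auto
  then show ?thesis unfolding y_eq(1) circle_point_def using \<open>sin s = 0\<close> by auto
qed

lemma finite_crossings: "finite (crossings (all_edges V) p a)"
  and card_crossings_le: "card (crossings (all_edges V) p a) \<le> 2 * (card V choose 2)\<^sup>2"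
proof -
  let ?E = "all_edges V"
  define common where "common = (\<lambda>(e, f). if e = f then {} else edge_interior p a e \<inter> edge_interior p a f)"
  have common: "finite (common ef) \<and> card (common ef) \<le> 2" if "ef \<in> ?E \<times> ?E" for ef
  proof (cases "common ef = {}")
    case False
    then obtain z where z_in: "z \<in> common ef" by blast
    obtain e f where ef_eq: "ef = (e, f)" by (cases ef)
    have "common ef \<subseteq> {z, - z}"
      using z_in that common_interior_points[of e f z] by (auto simp: ef_eq common_def split: if_splits)
    moreover have "card {z, - z} \<le> 2" by (simp add: card_insert_if)
    ultimately show ?thesis using card_mono[of "{z, - z}" "common ef"] by (auto intro: finite_subset)
  qed simp
  let ?g = "\<lambda>((e, f), x). ({e, f}, x)"
  have finite_pairs: "finite (Sigma (?E \<times> ?E) common)" using finite_V common by auto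
  have crossings_subset: "crossings ?E p a \<subseteq> ?g ` Sigma (?E \<times> ?E) common"
    unfolding crossings_def common_def by (force simp: image_iff)
  then show "finite (crossings ?E p a)" using finite_pairs finite_subset by blast
  have "card (crossings ?E p a) \<le> card (?g ` Sigma (?E \<times> ?E) common)"
    using finite_pairs crossings_subset by (intro card_mono) auto
  also have "\<dots> \<le> card (Sigma (?E \<times> ?E) common)" using finite_pairs by (rule card_image_le)
  also have "\<dots> = (\<Sum>ef\<in>?E \<times> ?E. card (common ef))" using finite_V common by simp
  also have "\<dots> \<le> (\<Sum>ef\<in>?E \<times> ?E. 2)" using common by (intro sum_mono) blast
  finally show "card (crossings ?E p a) \<le> 2 * (card V choose 2)\<^sup>2"
    using finite_V by (simp add: card_cartesian_product card_all_edges power2_eq_square mult.commute)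
qed

end

section \<open>A lower bound for the number of crossings\<close>

lemma eventually_poly_nonzero_at:
  fixes P :: "real poly"
  assumes "poly P c \<noteq> 0"
  shows "\<forall>\<^sub>F x in at a. poly P x \<noteq> 0"
proof -
  have "P \<noteq> 0" using assms by auto
  then have "\<not> a islimpt {x. poly P x = 0}" by (intro islimpt_finite poly_roots_finite)
  then show ?thesis by (simp add: islimpt_iff_eventually)
qed

definition moment :: "real \<Rightarrow> real ^ 3" where
  "moment s = vector [1, s, s\<^sup>2]"

lemma moment_nth [simp]: "moment s $ 1 = 1" "moment s $ 2 = s" "moment s $ 3 = s\<^sup>2"
  by (simp_all add: moment_def)

lemma det3_moment: "det3 (moment r) (moment s) (moment t) = (s - r) * (t - r) * (t - s)"
  by (simp add: det3_expand power2_eq_square algebra_simps)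

lemma eventually_general_position:
  fixes u :: "'a \<Rightarrow> real ^ 3"
  assumes "finite I" and inj: "inj_on s I"
  shows "\<forall>\<^sub>F \<eta> in at 0. general_position I (\<lambda>i. (1 - \<eta>) *\<^sub>R u i + \<eta> *\<^sub>R moment (s i))"
proof -
  define b where "b \<eta> i = (1 - \<eta>) *\<^sub>R u i + \<eta> *\<^sub>R moment (s i)" for \<eta> i
  define B where "B i c = [:u i $ c, moment (s i) $ c - u i $ c:]" for i c
  have poly_B: "poly (B i c) \<eta> = b \<eta> i $ c" for i c \<eta>
    by (simp add: B_def b_def algebra_simps)
  have b_1: "b 1 i = moment (s i)" for i by (simp add: b_def)
  have "\<forall>\<^sub>F \<eta> in at 0. b \<eta> i $ 1 \<noteq> 0" for i
    using eventually_poly_nonzero_at[of "B i 1" 1 0] by (simp add: poly_B b_1)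
  moreover have "\<forall>\<^sub>F \<eta> in at 0. i \<noteq> j \<longrightarrow> b \<eta> i $ 2 * b \<eta> j $ 1 \<noteq> b \<eta> j $ 2 * b \<eta> i $ 1"
    if "i \<in> I" "j \<in> I" for i j
    using eventually_poly_nonzero_at[of "B i 2 * B j 1 - B j 2 * B i 1" 1 0] inj that
    by (cases "i = j") (auto simp: poly_B b_1 inj_on_eq_iff)
  moreover have "\<forall>\<^sub>F \<eta> in at 0. i \<noteq> j \<and> j \<noteq> k \<and> i \<noteq> k \<longrightarrow> det3 (b \<eta> i) (b \<eta> j) (b \<eta> k) \<noteq> 0"
    if "i \<in> I" "j \<in> I" "k \<in> I" for i j k
  proof -
    define D where "D = B i 1 * (B j 2 * B k 3 - B k 2 * B j 3) - B i 2 * (B j 1 * B k 3 - B k 1 * B j 3)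
      + B i 3 * (B j 1 * B k 2 - B k 1 * B j 2)"
    have "poly D \<eta> = det3 (b \<eta> i) (b \<eta> j) (b \<eta> k)" for \<eta>
      by (simp add: D_def poly_B det3_expand)
    then show ?thesis
      using eventually_poly_nonzero_at[of D 1 0] det3_moment[of "s i" "s j" "s k"] inj that
      by (cases "i \<noteq> j \<and> j \<noteq> k \<and> i \<noteq> k") (auto simp: b_1 inj_on_eq_iff)
  qed
  ultimately show ?thesis
    unfolding general_position_def b_def[symmetric]
    by (intro eventually_conj eventually_ball_finite \<open>finite I\<close> ballI)
qed

lemma convex_hull_4E:
  assumes "z \<in> convex hull {u, v, x, y}"
  obtains A B C D where "A \<ge> 0" "B \<ge> 0" "C \<ge> 0" "D \<ge> 0" "A + B + C + D = 1"
    "z = A *\<^sub>R u + B *\<^sub>R v + C *\<^sub>R x + D *\<^sub>R y"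
proof -
  obtain r s b where outer: "r \<ge> 0" "s \<ge> 0" "r + s = 1" "b \<in> convex hull {v, x, y}" "z = r *\<^sub>R u + s *\<^sub>R b"
    using assms by (auto simp: convex_hull_insert[of "{v, x, y}"])
  then obtain B C D where inner: "b = B *\<^sub>R v + C *\<^sub>R x + D *\<^sub>R y" "B \<ge> 0" "C \<ge> 0" "D \<ge> 0" "B + C + D = 1"
    by (auto simp: convex_hull_3)
  have "r + s * B + s * C + s * D = 1" using outer(3) inner(5) by (simp add: add.assoc flip: distrib_left)
  then show thesis using that[of r "s * B" "s * C" "s * D"] outer inner by (simp add: algebra_simps)
qed

context complete_drawing
begin

lemma nonneg_combination_neq_0:
  assumes "u \<in> V" "v \<in> V" "p u \<noteq> - p v" "0 \<le> A" "0 \<le> B" "A \<noteq> 0 \<or> B \<noteq> 0"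
  shows "A *\<^sub>R p u + B *\<^sub>R p v \<noteq> 0"
proof
  assume "A *\<^sub>R p u + B *\<^sub>R p v = 0"
  then have balance: "A *\<^sub>R p u = B *\<^sub>R (- p v)" by (simp add: eq_neg_iff_add_eq_0)
  then have "norm (A *\<^sub>R p u) = norm (B *\<^sub>R (- p v))" by simp
  then have "A = B" using norm_p assms by simp
  then have "A *\<^sub>R p u = A *\<^sub>R (- p v)" "A \<noteq> 0" using balance assms by auto
  then show False using assms(3) by (metis scaleR_left_imp_eq)
qed

lemma nonneg_combination_in_arc:
  assumes ends: "u \<in> V" "v \<in> V" "u \<noteq> v" "p u \<noteq> - p v"
    and coeffs: "0 \<le> A" "0 \<le> B" "norm (A *\<^sub>R p u + B *\<^sub>R p v) = 1"
  shows "A *\<^sub>R p u + B *\<^sub>R p v \<in> a {u, v}"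
proof -
  obtain w \<theta> where circle: "0 < \<theta>" "\<theta> \<le> pi" "orthonormal (p u) w" "p v = circle_point (p u) w \<theta>"
    "a {u, v} = circle_arc (p u) w \<theta>" using edge_circle_arc[OF ends(1-3)] .
  have "\<theta> \<noteq> pi" using circle(4) ends(4) by auto
  then show ?thesis
    using nonneg_combination_in_circle_arc[OF circle(3,1) _ coeffs(1,2)] circle(2) coeffs(3)
    unfolding circle(4,5) by simp
qed

lemma disjoint_arcs_separated:
  assumes first_arc: "i \<in> V" "j \<in> V" "i \<noteq> j" "p i \<noteq> - p j"
    and second_arc: "k \<in> V" "l \<in> V" "k \<noteq> l" "p k \<noteq> - p l"
    and disjoint: "a {i, j} \<inter> a {k, l} = {}"
  obtains h where "h \<bullet> p i > 0" "h \<bullet> p j > 0" "h \<bullet> p k < 0" "h \<bullet> p l < 0"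
proof -
  define K where "K = convex hull {p i, p j, - p k, - p l}"
  have "0 \<notin> K"
  proof
    assume "0 \<in> K"
    then obtain A B C D where coeff: "A \<ge> 0" "B \<ge> 0" "C \<ge> 0" "D \<ge> 0" "A + B + C + D = 1"
      "0 = A *\<^sub>R p i + B *\<^sub>R p j + C *\<^sub>R (- p k) + D *\<^sub>R (- p l)"
      unfolding K_def by (rule convex_hull_4E)
    define z where "z = A *\<^sub>R p i + B *\<^sub>R p j"
    have z_eq: "z = C *\<^sub>R p k + D *\<^sub>R p l" using coeff(6) by (simp add: z_def algebra_simps)
    consider "A \<noteq> 0 \<or> B \<noteq> 0" | "C \<noteq> 0 \<or> D \<noteq> 0" using coeff(5) by fastforce
    then have "z \<noteq> 0"
      by cases (use nonneg_combination_neq_0[OF first_arc(1,2,4) coeff(1,2)]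
          nonneg_combination_neq_0[OF second_arc(1,2,4) coeff(3,4)] z_eq z_def in auto)
    then have unit: "norm ((1 / norm z) *\<^sub>R z) = 1" by simp
    have "(1 / norm z) *\<^sub>R z = (A / norm z) *\<^sub>R p i + (B / norm z) *\<^sub>R p j"
      "(1 / norm z) *\<^sub>R z = (C / norm z) *\<^sub>R p k + (D / norm z) *\<^sub>R p l"
      by (simp add: z_def scaleR_add_right, simp add: z_eq scaleR_add_right)
    then have "(1 / norm z) *\<^sub>R z \<in> a {i, j}" "(1 / norm z) *\<^sub>R z \<in> a {k, l}"
      using nonneg_combination_in_arc[OF first_arc, of "A / norm z" "B / norm z"]
        nonneg_combination_in_arc[OF second_arc, of "C / norm z" "D / norm z"] coeff(1-4) unit by auto
    then show False using disjoint by blast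
  qed
  moreover have "convex K" "closed K"
    by (simp_all add: K_def compact_imp_closed finite_imp_compact_convex_hull)
  ultimately obtain h b where separates: "0 < b" "\<And>x. x \<in> K \<Longrightarrow> h \<bullet> x > b"
    using separating_hyperplane_closed_0[of K] by blast
  have "{p i, p j, - p k, - p l} \<subseteq> K" unfolding K_def by (rule hull_subset)
  then have "b < h \<bullet> p i" "b < h \<bullet> p j" "b < h \<bullet> (- p k)" "b < h \<bullet> (- p l)"
    by (auto intro!: separates(2) simp del: inner_minus_right)
  then show thesis using that[of h] separates(1) by simp
qed

lemma eventually_crossing_arcs_meet:
  assumes first_arc: "i \<in> V" "j \<in> V" "p i \<noteq> - p j" and second_arc: "k \<in> V" "l \<in> V" "p k \<noteq> - p l"
    and lim: "\<And>v. v \<in> V \<Longrightarrow> ((\<lambda>\<eta>. b \<eta> v) \<longlongrightarrow> p v) F"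
  shows "\<forall>\<^sub>F \<eta> in F. crossing_signs (det3_sign (b \<eta>)) i j k l \<longrightarrow> a {i, j} \<inter> a {k, l} \<noteq> {}"
proof (cases "i \<noteq> j \<and> k \<noteq> l \<and> a {i, j} \<inter> a {k, l} = {}")
  case False
  then have "crossing_signs (det3_sign (b \<eta>)) i j k l \<longrightarrow> a {i, j} \<inter> a {k, l} \<noteq> {}" for \<eta>
    using crossing_signs_imp_distinct[of "b \<eta>" i j k l] by auto
  then show ?thesis by simp
next
  case True
  obtain h where separates: "h \<bullet> p i > 0" "h \<bullet> p j > 0" "h \<bullet> p k < 0" "h \<bullet> p l < 0"
    using disjoint_arcs_separated first_arc second_arc True by blast
  have inner_lim: "((\<lambda>\<eta>. h \<bullet> b \<eta> v) \<longlongrightarrow> h \<bullet> p v) F" if "v \<in> V" for v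
    using lim[OF that] by (intro tendsto_intros)
  have "\<forall>\<^sub>F \<eta> in F. h \<bullet> b \<eta> i > 0" "\<forall>\<^sub>F \<eta> in F. h \<bullet> b \<eta> j > 0"
    "\<forall>\<^sub>F \<eta> in F. h \<bullet> b \<eta> k < 0" "\<forall>\<^sub>F \<eta> in F. h \<bullet> b \<eta> l < 0"
    using order_tendstoD[OF inner_lim] first_arc(1,2) second_arc(1,2) separates by auto
  then show ?thesis
  proof eventually_elim
    case (elim \<eta>)
    have False if crossing: "crossing_signs (det3_sign (b \<eta>)) i j k l"
    proof -
      obtain c1 c2 c3 c4 where cones: "c1 > 0" "c2 > 0" "c3 > 0" "c4 > 0"
        "c1 *\<^sub>R b \<eta> i + c2 *\<^sub>R b \<eta> j = c3 *\<^sub>R b \<eta> k + c4 *\<^sub>R b \<eta> l"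
        using crossing_signs_imp_cones_meet[OF crossing] .
      have "0 < h \<bullet> (c1 *\<^sub>R b \<eta> i + c2 *\<^sub>R b \<eta> j)"
        using cones(1,2) elim(1,2) by (simp add: inner_add_right add_pos_pos)
      moreover have "h \<bullet> (c3 *\<^sub>R b \<eta> k + c4 *\<^sub>R b \<eta> l) < 0"
        using cones(3,4) elim(3,4) by (simp add: inner_add_right add_neg_neg mult_pos_neg)
      ultimately show False using cones(5) by simp
    qed
    then show ?case by blast
  qed
qed

lemma sum4_antipodal_le: "sum4 V (\<lambda>i j k l. of_bool (p i = - p j)) \<le> real (card V) ^ 3"
proof -
  have "(\<Sum>j\<in>V. of_bool (p i = - p j)) \<le> (1 :: real)" for i
  proof -
    have "card {j \<in> V. p i = - p j} \<le> 1"
      using finite_V p_eq_imp by (force simp: card_le_Suc0_iff_eq)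
    then show ?thesis using finite_V by (simp add: Int_def)
  qed
  then have "(\<Sum>i\<in>V. \<Sum>j\<in>V. of_bool (p i = - p j)) \<le> (\<Sum>i\<in>V. 1 :: real)"
    by (intro sum_mono)
  then have "(real (card V))\<^sup>2 * (\<Sum>i\<in>V. \<Sum>j\<in>V. of_bool (p i = - p j)) \<le> (real (card V))\<^sup>2 * real (card V)"
    by (intro mult_left_mono) simp_all
  then show ?thesis
    by (simp add: sum4_def power2_eq_square power3_eq_cube mult.assoc flip: sum_distrib_left)
qed

definition crossings_imp_arcs_meet :: "('v \<Rightarrow> real ^ 3) \<Rightarrow> bool" where
  "crossings_imp_arcs_meet b \<longleftrightarrow> (\<forall>i\<in>V. \<forall>j\<in>V. \<forall>k\<in>V. \<forall>l\<in>V. p i \<noteq> - p j \<and> p k \<noteq> - p l \<longrightarrow>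
    (crossing_signs (det3_sign b) i j k l \<longrightarrow> a {i, j} \<inter> a {k, l} \<noteq> {}))"

lemma general_position_perturbation:
  obtains b where "general_position V b" "crossings_imp_arcs_meet b"
proof -
  obtain s :: "'v \<Rightarrow> nat" where inj_s: "inj_on s V" using finite_imp_inj_to_nat_seg[OF finite_V] by blast
  define b where "b = (\<lambda>\<eta> v. (1 - \<eta>) *\<^sub>R p v + \<eta> *\<^sub>R moment (real (s v)))"
  have "((\<lambda>\<eta>. b \<eta> v) \<longlongrightarrow> (1 - 0) *\<^sub>R p v + 0 *\<^sub>R moment (real (s v))) (at 0)" for v
    unfolding b_def by (intro tendsto_intros)
  then have lim: "((\<lambda>\<eta>. b \<eta> v) \<longlongrightarrow> p v) (at 0)" for v by simp
  have "\<forall>\<^sub>F \<eta> in at 0. general_position V (b \<eta>)"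
    unfolding b_def using inj_s by (intro eventually_general_position finite_V) (auto simp: inj_on_def)
  moreover have "\<forall>\<^sub>F \<eta> in at 0. crossings_imp_arcs_meet (b \<eta>)"
    unfolding crossings_imp_arcs_meet_def
  proof (intro eventually_ball_finite finite_V ballI)
    fix i j k l assume "i \<in> V" "j \<in> V" "k \<in> V" "l \<in> V"
    then show "\<forall>\<^sub>F \<eta> in at 0. p i \<noteq> - p j \<and> p k \<noteq> - p l \<longrightarrow>
        (crossing_signs (det3_sign (b \<eta>)) i j k l \<longrightarrow> a {i, j} \<inter> a {k, l} \<noteq> {})"
      using eventually_crossing_arcs_meet[of i j k l b "at 0", OF _ _ _ _ _ _ lim]
      by (cases "p i \<noteq> - p j \<and> p k \<noteq> - p l") simp_all
  qed
  ultimately have "\<exists>\<eta>. general_position V (b \<eta>) \<and> crossings_imp_arcs_meet (b \<eta>)"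
    by (intro eventually_happens'[OF at_neq_bot] eventually_conj)
  then show thesis by (elim exE conjE) (rule that)
qed

lemma meeting_arcs_count:
  assumes even: "even (card V)"
  shows "sum4 V (\<lambda>i j k l. of_bool (distinct [i, j, k, l] \<and> a {i, j} \<inter> a {k, l} \<noteq> {}))
    \<ge> real (card V) ^ 4 / 8 - 12 * real (card V) ^ 3"
proof -
  let ?meet = "\<lambda>i j k l. of_bool (distinct [i, j, k, l] \<and> a {i, j} \<inter> a {k, l} \<noteq> {}) :: real"
  obtain b where generic: "general_position V b" and meet: "crossings_imp_arcs_meet b"
    by (rule general_position_perturbation)
  have "real (card V) ^ 4 / 8 - 10 * real (card V) ^ 3
      \<le> sum4 V (\<lambda>i j k l. of_bool (crossing_signs (det3_sign b) i j k l))"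
    by (rule general_position_crossing_count[OF finite_V even generic])
  also have "\<dots> \<le> sum4 V (\<lambda>i j k l. ?meet i j k l + (of_bool (p i = - p j) + of_bool (p k = - p l)))"
  proof (rule sum4_mono)
    fix i j k l assume in_V: "i \<in> V" "j \<in> V" "k \<in> V" "l \<in> V"
    show "of_bool (crossing_signs (det3_sign b) i j k l)
        \<le> ?meet i j k l + (of_bool (p i = - p j) + of_bool (p k = - p l))"
    proof (cases "crossing_signs (det3_sign b) i j k l")
      case True
      then have "a {i, j} \<inter> a {k, l} \<noteq> {} \<or> p i = - p j \<or> p k = - p l"
        using meet in_V unfolding crossings_imp_arcs_meet_def by blast
      then show ?thesis using crossing_signs_imp_distinct[OF True] by auto
    qed simp
  qed
  also have "\<dots> = sum4 V ?meet + 2 * sum4 V (\<lambda>i j k l. of_bool (p i = - p j))"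
    unfolding sum4_add using sum4_permute(5)[of V "\<lambda>i j k l. of_bool (p i = - p j)"] by simp
  finally show ?thesis using sum4_antipodal_le by linarith
qed

end

definition splitting :: "'a \<times> 'a \<times> 'a \<times> 'a \<Rightarrow> 'a set set" where
  "splitting = (\<lambda>(i, j, k, l). {{i, j}, {k, l}})"

lemma card_le_splittings:
  assumes "finite K"
  shows "card K \<le> 8 * card (splitting ` K)"
proof -
  have "card {q \<in> K. splitting q = d} \<le> 8" if d_in: "d \<in> splitting ` K" for d
  proof -
    obtain i j k l where d_eq: "d = {{i, j}, {k, l}}" using d_in by (auto simp: splitting_def)
    let ?L = "[(i, j, k, l), (j, i, k, l), (i, j, l, k), (j, i, l, k),
      (k, l, i, j), (l, k, i, j), (k, l, j, i), (l, k, j, i)]"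
    have "{q \<in> K. splitting q = d} \<subseteq> set ?L"
    proof
      fix q assume "q \<in> {q \<in> K. splitting q = d}"
      moreover obtain i' j' k' l' where q_eq: "q = (i', j', k', l')" by (cases q)
      ultimately have "{{i', j'}, {k', l'}} = {{i, j}, {k, l}}" by (simp add: splitting_def d_eq)
      then show "q \<in> set ?L" unfolding doubleton_eq_iff by (elim disjE conjE; simp add: q_eq)
    qed
    then have "card {q \<in> K. splitting q = d} \<le> card (set ?L)" by (intro card_mono) simp_all
    also have "\<dots> \<le> 8" using card_length[of ?L] by simp
    finally show ?thesis .
  qed
  then have "(\<Sum>d\<in>splitting ` K. card {q \<in> K. splitting q = d}) \<le> (\<Sum>d\<in>splitting ` K. 8)"
    by (rule sum_mono)
  moreover have "card K = (\<Sum>d\<in>splitting ` K. card {q \<in> K. splitting q = d})"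
    unfolding card_eq_sum by (rule sum.image_gen[OF assms])
  ultimately show ?thesis by simp
qed

context complete_drawing
begin

lemma meeting_arcs_imp_crossing:
  assumes in_V: "i \<in> V" "j \<in> V" "k \<in> V" "l \<in> V" and dist: "distinct [i, j, k, l]"
    and meet: "a {i, j} \<inter> a {k, l} \<noteq> {}"
  shows "{{i, j}, {k, l}} \<in> fst ` crossings (all_edges V) p a"
proof -
  obtain z where z_in: "z \<in> a {i, j}" "z \<in> a {k, l}" using meet by blast
  have "p i \<notin> a {k, l}" "p j \<notin> a {k, l}" "p k \<notin> a {i, j}" "p l \<notin> a {i, j}"
    using in_V dist vertex_not_on_arc[of "{k, l}"] vertex_not_on_arc[of "{i, j}"] by auto
  then have "z \<in> edge_interior p a {i, j} \<inter> edge_interior p a {k, l}"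
    using z_in by (auto simp: edge_interior_def)
  moreover have "{i, j} \<in> all_edges V" "{k, l} \<in> all_edges V" "{i, j} \<noteq> {k, l}"
    using in_V dist by (auto simp: doubleton_eq_iff)
  ultimately have "({{i, j}, {k, l}}, z) \<in> crossings (all_edges V) p a"
    unfolding crossings_def by blast
  then show ?thesis by force
qed

lemma crossings_lower_bound:
  assumes even: "even (card V)"
  shows "8 * real (card (crossings (all_edges V) p a)) \<ge> real (card V) ^ 4 / 8 - 12 * real (card V) ^ 3"
proof -
  define K where "K = {(i, j, k, l) \<in> V \<times> V \<times> V \<times> V. distinct [i, j, k, l] \<and> a {i, j} \<inter> a {k, l} \<noteq> {}}"
  have K_subset: "K \<subseteq> V \<times> V \<times> V \<times> V" "finite (V \<times> V \<times> V \<times> V)" using finite_V by (auto simp: K_def)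
  then have "finite K" by (rule finite_subset)
  have split_crossing: "splitting q \<in> fst ` crossings (all_edges V) p a" if "q \<in> K" for q
  proof -
    obtain i j k l where q_eq: "q = (i, j, k, l)" by (cases q)
    then show ?thesis using that meeting_arcs_imp_crossing[of i j k l] by (simp add: K_def splitting_def)
  qed
  have "sum4 V (\<lambda>i j k l. of_bool (distinct [i, j, k, l] \<and> a {i, j} \<inter> a {k, l} \<noteq> {}))
      = (\<Sum>q\<in>V \<times> V \<times> V \<times> V. of_bool (q \<in> K))"
    unfolding sum4_def sum.cartesian_product by (intro sum.cong refl) (auto simp: K_def)
  also have "\<dots> = real (card K)" using K_subset by (simp add: Int_absorb1)
  finally have "real (card V) ^ 4 / 8 - 12 * real (card V) ^ 3 \<le> real (card K)"
    using meeting_arcs_count[OF even] by simp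
  also have "card K \<le> 8 * card (splitting ` K)" using \<open>finite K\<close> by (rule card_le_splittings)
  also have "card (splitting ` K) \<le> card (fst ` crossings (all_edges V) p a)"
    using split_crossing finite_crossings by (intro card_mono) auto
  also have "\<dots> \<le> card (crossings (all_edges V) p a)" using finite_crossings by (rule card_image_le)
  finally show ?thesis by simp
qed

end

section \<open>The limit\<close>

lemma general_position_moment:
  "inj_on s I \<Longrightarrow> general_position I (\<lambda>i. moment (s i))"
  by (auto simp: general_position_def det3_moment inj_on_eq_iff)

lemma general_position_scaleR:
  assumes "general_position I a" and "\<And>i. i \<in> I \<Longrightarrow> c i \<noteq> 0"
  shows "general_position I (\<lambda>i. c i *\<^sub>R a i)"
proof -
  have "det3 (r *\<^sub>R u) (s *\<^sub>R v) (t *\<^sub>R w) = r * s * t * det3 u v w" for r s t u v w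
    by (simp add: det3_expand algebra_simps)
  moreover have "(r * x) * (s * y) = (s * x') * (r * y') \<longleftrightarrow> x * y = x' * y'"
    if "r \<noteq> 0" "s \<noteq> 0" for r s x y x' y' :: real
    using that by (auto simp: mult_ac)
  ultimately show ?thesis using assms by (simp add: general_position_def)
qed

lemma general_position_imp_neq:
  assumes "general_position I a" "i \<in> I" "j \<in> I" "i \<noteq> j"
  shows "a i \<noteq> a j" "a i \<noteq> - a j"
proof -
  show "a i \<noteq> a j" "a i \<noteq> - a j" using general_positionD(2)[OF assms] by auto
qed

lemma det3_circle_points: "det3 x (circle_point x w s) (circle_point x w t) = 0"
  by (simp add: det3_expand circle_point_def algebra_simps)

lemma complete_drawing_general_position:
  assumes "finite V" and generic: "general_position V p" and unit: "\<And>v. v \<in> V \<Longrightarrow> norm (p v) = 1"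
  shows "\<exists>a. complete_drawing V p a"
proof -
  note neq = general_position_imp_neq[OF generic]
  define a where "a e = (SOME A. \<forall>u v. e = {u, v} \<longrightarrow> min_geodesic_arc (p u) (p v) A)" for e
  have arc: "min_geodesic_arc (p u) (p v) (a {u, v})" if uv_in: "u \<in> V" "v \<in> V" "u \<noteq> v" for u v
  proof -
    obtain A where "min_geodesic_arc (p u) (p v) A"
      using min_geodesic_arc_exists[OF unit unit neq] uv_in by blast
    moreover from this have "min_geodesic_arc (p v) (p u) A"
      using min_geodesic_arc_commute unit neq uv_in by blast
    ultimately have "\<exists>A. \<forall>u' v'. {u, v} = {u', v'} \<longrightarrow> min_geodesic_arc (p u') (p v') A"
      by (auto simp: doubleton_eq_iff)
    from someI_ex[OF this] show ?thesis unfolding a_def by blast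
  qed
  have off_arc: "p w \<notin> a {u, v}" if uv_in: "u \<in> V" "v \<in> V" "u \<noteq> v" and w_in: "w \<in> V" "w \<noteq> u" "w \<noteq> v" for u v w
  proof
    assume on_arc: "p w \<in> a {u, v}"
    obtain t \<theta> where "p v = circle_point (p u) t \<theta>" "a {u, v} = circle_arc (p u) t \<theta>"
      using min_geodesic_arc_imp_circle_arc[OF arc[OF uv_in] unit unit neq(1)] uv_in by metis
    then have "det3 (p u) (p v) (p w) = 0" using on_arc by (auto simp: circle_arc_def det3_circle_points)
    then show False using general_positionD(3)[OF generic, of u v w] uv_in w_in by simp
  qed
  have "spherical_geodesic_drawing V (all_edges V) p a"
    unfolding spherical_geodesic_drawing_def
  proof (intro conjI allI impI ballI)
    show "p ` V \<subseteq> sphere 0 1" using unit by auto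
    show "inj_on p V" using neq(1) by (meson inj_onI)
    show "min_geodesic_arc (p u) (p v) (a {u, v})" if "{u, v} \<in> all_edges V" for u v
      using that arc by simp
    show "p w \<notin> a e" if "e \<in> all_edges V" "w \<in> V - e" for e w
      using that off_arc by (auto elim!: all_edges_cases)
  qed
  then show ?thesis using \<open>finite V\<close> by (intro exI) unfold_locales
qed

lemma optimal_drawing:
  obtains p a where "complete_drawing {..<n} p a" "cr_S2_K n = card (crossings (all_edges {..<n}) p a)"
proof -
  have nonzero: "norm (moment s) \<noteq> 0" for s
    by (metis moment_nth(1) norm_eq_zero zero_index zero_neq_one)
  then have "general_position {..<n} (\<lambda>i. (1 / norm (moment (real i))) *\<^sub>R moment (real i))"
    by (intro general_position_scaleR general_position_moment) (auto simp: inj_on_def)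
  then have "\<exists>p a. complete_drawing {..<n} p a"
    using complete_drawing_general_position[of "{..<n}"] nonzero by fastforce
  then have "\<exists>k p a. spherical_geodesic_drawing {..<n} (complete_edges n) p a
      \<and> k = card (crossings (complete_edges n) p a)"
    by (auto simp: complete_edges_eq complete_drawing_def)
  from LeastI_ex[OF this] show thesis
    using that unfolding cr_S2_K_def spherical_geodesic_crossing_number_def
    by (auto simp: complete_edges_eq complete_drawing_def)
qed

subsection \<open>Deleting a vertex\<close>

lemma spherical_geodesic_drawing_comp:
  assumes drawing: "spherical_geodesic_drawing V E p a" and inj_h: "inj_on h W" "h ` W \<subseteq> V"
    and edges: "\<And>e. e \<in> F \<Longrightarrow> e \<subseteq> W \<and> h ` e \<in> E"
  shows "spherical_geodesic_drawing W F (p \<circ> h) (\<lambda>e. a (h ` e))"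
  unfolding spherical_geodesic_drawing_def
proof (intro conjI allI impI ballI)
  show "(p \<circ> h) ` W \<subseteq> sphere 0 1"
    using drawing inj_h(2) unfolding spherical_geodesic_drawing_def by (auto simp: image_subset_iff)
  show "inj_on (p \<circ> h) W"
    using drawing inj_h unfolding spherical_geodesic_drawing_def by (auto intro: comp_inj_on inj_on_subset)
next
  fix u v assume "{u, v} \<in> F"
  then have "{h u, h v} \<in> E" using edges by force
  then show "min_geodesic_arc ((p \<circ> h) u) ((p \<circ> h) v) (a (h ` {u, v}))"
    using drawing unfolding spherical_geodesic_drawing_def by simp
next
  fix e w assume "e \<in> F" "w \<in> W - e"
  then have "h ` e \<in> E" "h w \<in> V - h ` e"
    using edges inj_h by (auto dest: inj_onD)
  then show "(p \<circ> h) w \<notin> a (h ` e)"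
    using drawing unfolding spherical_geodesic_drawing_def by simp
qed

lemma card_crossings_comp_le:
  assumes inj_h: "inj_on h W" and F_subset: "F \<subseteq> Pow W"
    and finite_image: "finite (crossings ((`) h ` F) p a)"
  shows "card (crossings F (p \<circ> h) (\<lambda>e. a (h ` e))) \<le> card (crossings ((`) h ` F) p a)"
proof (rule card_inj_on_le[OF _ _ finite_image])
  let ?G = "map_prod ((`) ((`) h)) id :: _ \<times> (real ^ 3) \<Rightarrow> _"
  have inj: "inj_on ((`) h) F" using inj_on_image_Pow[OF inj_h] F_subset by (rule inj_on_subset)
  have "crossings F (p \<circ> h) (\<lambda>e. a (h ` e)) \<subseteq> Pow F \<times> UNIV" by (auto simp: crossings_def)
  then show "inj_on ?G (crossings F (p \<circ> h) (\<lambda>e. a (h ` e)))"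
    by (rule inj_on_subset[rotated]) (intro map_prod_inj_on inj_on_image_Pow inj inj_on_id)
  have interior: "edge_interior (p \<circ> h) (\<lambda>e. a (h ` e)) e = edge_interior p a (h ` e)" for e
    by (simp add: edge_interior_def image_comp)
  show "?G ` crossings F (p \<circ> h) (\<lambda>e. a (h ` e)) \<subseteq> crossings ((`) h ` F) p a"
  proof (rule image_subsetI)
    fix c assume "c \<in> crossings F (p \<circ> h) (\<lambda>e. a (h ` e))"
    then obtain e f x where c_eq: "c = ({e, f}, x)" "e \<in> F" "f \<in> F" "e \<noteq> f"
      "x \<in> edge_interior (p \<circ> h) (\<lambda>e. a (h ` e)) e" "x \<in> edge_interior (p \<circ> h) (\<lambda>e. a (h ` e)) f"
      by (rule crossingsE)
    have "h ` e \<noteq> h ` f" using inj c_eq(2-4) by (simp add: inj_on_eq_iff)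
    then have "({h ` e, h ` f}, x) \<in> crossings ((`) h ` F) p a"
      using c_eq(2,3) c_eq(5,6)[unfolded interior] by (intro crossingsI) auto
    then show "?G c \<in> crossings ((`) h ` F) p a" by (simp add: c_eq(1))
  qed
qed

lemma cr_S2_K_le:
  assumes "spherical_geodesic_drawing {..<n} (complete_edges n) p a"
  shows "cr_S2_K n \<le> card (crossings (complete_edges n) p a)"
  unfolding cr_S2_K_def spherical_geodesic_crossing_number_def by (rule Least_le) (use assms in blast)

lemma crossings_mono: "E \<subseteq> F \<Longrightarrow> crossings E p a \<subseteq> crossings F p a"
  by (auto elim!: crossingsE intro!: crossingsI)

lemma crossings_avoiding:
  "crossings {e \<in> E. v \<notin> e} p a = {c \<in> crossings E p a. v \<notin> \<Union> (fst c)}"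
proof (intro equalityI subsetI)
  fix c assume "c \<in> crossings {e \<in> E. v \<notin> e} p a"
  then show "c \<in> {c \<in> crossings E p a. v \<notin> \<Union> (fst c)}" by (rule crossingsE) (auto intro: crossingsI)
next
  fix c assume c_in: "c \<in> {c \<in> crossings E p a. v \<notin> \<Union> (fst c)}"
  then have "c \<in> crossings E p a" by simp
  then show "c \<in> crossings {e \<in> E. v \<notin> e} p a" by (rule crossingsE) (use c_in in \<open>auto intro: crossingsI\<close>)
qed

lemma all_edges_mono: "W \<subseteq> V \<Longrightarrow> all_edges W \<subseteq> all_edges V"
  by (auto simp: all_edges_def)

context complete_drawing
begin

lemma cr_S2_K_card_le:
  assumes "W \<subseteq> V"
  shows "cr_S2_K (card W) \<le> card (crossings (all_edges W) p a)"
proof -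
  have "finite W" using assms finite_V finite_subset by blast
  then obtain h where bij_h: "bij_betw h {..<card W} W"
    using ex_bij_betw_nat_finite by (metis atLeast0LessThan)
  have inj: "inj_on h {..<card W}" and image: "h ` {..<card W} = W" using bij_h by (auto simp: bij_betw_def)
  have edges: "h ` e \<in> all_edges W" if "e \<in> complete_edges (card W)" for e
  proof -
    have "inj_on h e" using inj that by (auto simp: complete_edges_def intro: inj_on_subset)
    then show ?thesis using that image by (auto simp: complete_edges_def all_edges_def card_image)
  qed
  have "crossings ((`) h ` complete_edges (card W)) p a \<subseteq> crossings (all_edges W) p a"
    using edges by (intro crossings_mono) blast
  moreover have "finite (crossings (all_edges W) p a)"
    using finite_crossings crossings_mono[OF all_edges_mono[OF assms]] by (rule finite_subset[rotated])
  ultimately have "card (crossings (complete_edges (card W)) (p \<circ> h) (\<lambda>e. a (h ` e)))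
      \<le> card (crossings (all_edges W) p a)"
    using card_crossings_comp_le[OF inj, of "complete_edges (card W)" p a]
    by (auto simp: complete_edges_def intro: order_trans card_mono finite_subset)
  moreover have "spherical_geodesic_drawing {..<card W} (complete_edges (card W)) (p \<circ> h) (\<lambda>e. a (h ` e))"
    using edges all_edges_mono[OF assms] image assms
    by (intro spherical_geodesic_drawing_comp[OF drawing inj]) (auto simp: complete_edges_def)
  ultimately show ?thesis using cr_S2_K_le by (meson order_trans)
qed

lemma sum_card_crossings_delete:
  "(\<Sum>v\<in>V. card (crossings (all_edges (V - {v})) p a)) = (card V - 4) * card (crossings (all_edges V) p a)"
proof -
  let ?C = "crossings (all_edges V) p a"
  have "all_edges (V - {v}) = {e \<in> all_edges V. v \<notin> e}" for v by (auto simp: all_edges_def)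
  then have "(\<Sum>v\<in>V. card (crossings (all_edges (V - {v})) p a)) = (\<Sum>v\<in>V. card {c \<in> ?C. v \<notin> \<Union> (fst c)})"
    by (simp only: crossings_avoiding)
  also have "\<dots> = (\<Sum>c\<in>?C. card {v \<in> V. v \<notin> \<Union> (fst c)})"
    unfolding card_eq_sum using finite_V finite_crossings by (rule sum.swap_restrict)
  also have "\<dots> = (\<Sum>c\<in>?C. card V - 4)"
  proof (rule sum.cong[OF refl])
    fix c assume "c \<in> ?C"
    then obtain e f x where c_eq: "c = ({e, f}, x)" and edges: "e \<in> all_edges V" "f \<in> all_edges V" "e \<noteq> f"
      "x \<in> edge_interior p a e" "x \<in> edge_interior p a f"
      by (rule crossingsE)
    have "finite e" "finite f" "card e = 2" "card f = 2" "e \<union> f \<subseteq> V"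
      using edges(1,2) by (auto simp: all_edges_def intro: card_ge_0_finite)
    then have "card (e \<union> f) = 4" using crossing_edges_disjoint[OF edges] by (simp add: card_Un_disjoint)
    moreover have "{v \<in> V. v \<notin> \<Union> (fst c)} = V - (e \<union> f)" by (auto simp: c_eq)
    ultimately show "card {v \<in> V. v \<notin> \<Union> (fst c)} = card V - 4"
      using \<open>finite e\<close> \<open>finite f\<close> \<open>e \<union> f \<subseteq> V\<close> by (simp add: card_Diff_subset)
  qed
  finally show ?thesis by (simp add: mult.commute)
qed

end

lemma cr_S2_K_step: "Suc n * cr_S2_K n \<le> (Suc n - 4) * cr_S2_K (Suc n)"
proof -
  obtain p a where "complete_drawing {..<Suc n} p a"
    and optimal: "cr_S2_K (Suc n) = card (crossings (all_edges {..<Suc n}) p a)"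
    by (rule optimal_drawing)
  then interpret complete_drawing "{..<Suc n}" p a by simp
  have "cr_S2_K n \<le> card (crossings (all_edges ({..<Suc n} - {v})) p a)" if "v < Suc n" for v
    using cr_S2_K_card_le[of "{..<Suc n} - {v}"] that by simp
  then have "(\<Sum>v<Suc n. cr_S2_K n) \<le> (\<Sum>v<Suc n. card (crossings (all_edges ({..<Suc n} - {v})) p a))"
    by (intro sum_mono) simp
  then show ?thesis using sum_card_crossings_delete optimal by simp
qed

lemma cr_S2_K_upper: "cr_S2_K n \<le> 2 * n ^ 4"
proof -
  obtain p a where "complete_drawing {..<n} p a" "cr_S2_K n = card (crossings (all_edges {..<n}) p a)"
    by (rule optimal_drawing)
  then have "cr_S2_K n \<le> 2 * (n choose 2)\<^sup>2" using complete_drawing.card_crossings_le by fastforce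
  also have "n choose 2 \<le> n\<^sup>2"
    using binomial_le_pow[of 2 n] by (cases "2 \<le> n") (simp_all add: not_le binomial_eq_0)
  then have "2 * (n choose 2)\<^sup>2 \<le> 2 * (n\<^sup>2)\<^sup>2" by (intro mult_left_mono power_mono) simp_all
  finally show ?thesis by simp
qed

lemma cr_S2_K_lower: "real (cr_S2_K (2 * q)) \<ge> real (2 * q) ^ 4 / 64 - 3 / 2 * real (2 * q) ^ 3"
proof -
  obtain p a where "complete_drawing {..<2 * q} p a"
    and optimal: "cr_S2_K (2 * q) = card (crossings (all_edges {..<2 * q}) p a)"
    by (rule optimal_drawing)
  then interpret complete_drawing "{..<2 * q}" p a by simp
  show ?thesis using crossings_lower_bound optimal by simp
qed

lemma convergent_div_binomial:
  fixes f :: "nat \<Rightarrow> nat"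
  assumes step: "\<And>n. Suc n * f n \<le> (Suc n - k) * f (Suc n)" and bound: "\<And>n. f n \<le> C * n ^ k"
  shows "convergent (\<lambda>n. real (f n) / real (n choose k))"
proof -
  let ?X = "\<lambda>n. real (f n) / real (n choose k)"
  have "incseq ?X"
  proof (rule incseq_SucI)
    fix n show "?X n \<le> ?X (Suc n)"
    proof (cases "k \<le> n")
      case True
      then have pos: "n choose k > 0" "Suc n choose k > 0" "Suc n - k > 0" by simp_all
      have "(Suc n - k) * (f n * (Suc n choose k)) = f n * (Suc n * (n choose k))"
        using binomial_absorb_comp[of "Suc n" k] by (simp only: mult.left_commute diff_Suc_1)
      also have "\<dots> = (Suc n * f n) * (n choose k)" by (simp only: mult_ac)
      also have "\<dots> \<le> ((Suc n - k) * f (Suc n)) * (n choose k)" using step by (intro mult_right_mono) auto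
      finally have "f n * (Suc n choose k) \<le> f (Suc n) * (n choose k)"
        using pos(3) by (simp only: mult.assoc mult_le_cancel1)
      then have "real (f n) * real (Suc n choose k) \<le> real (f (Suc n)) * real (n choose k)"
        by (simp only: of_nat_mult[symmetric] of_nat_le_iff)
      then show ?thesis using pos(1,2) by (simp add: divide_le_eq pos_le_divide_eq mult_ac)
    qed (simp add: not_le binomial_eq_0)
  qed
  moreover have "?X n \<le> real C * real k ^ k" for n
  proof (cases "k \<le> n")
    case True
    have "real n ^ k \<le> real k ^ k * real (n choose k)"
      using binomial_ge_n_over_k_pow_k[OF True, where 'a = real]
      by (cases "k = 0") (simp_all add: power_divide divide_le_eq mult.commute)
    then have "real C * real n ^ k \<le> real C * (real k ^ k * real (n choose k))" by (intro mult_left_mono) auto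
    moreover have "real (f n) \<le> real (C * n ^ k)" using bound by (simp only: of_nat_le_iff)
    ultimately show ?thesis using True by (simp add: divide_le_eq mult_ac)
  qed (simp add: not_le binomial_eq_0)
  ultimately obtain L where "?X \<longlonglongrightarrow> L" using incseq_convergent[of ?X] by blast
  then show ?thesis by (rule convergentI)
qed

lemma binomial_4_div_hill_tendsto: "(\<lambda>n. real (n choose 4) / hill n) \<longlonglongrightarrow> 8 / 3"
proof -
  have "real (n choose 4) = real n * (real n - 1) * (real n - 2) * (real n - 3) / 24" for n
    by (simp add: binomial_gbinomial gbinomial_prod_rev eval_nat_numeral)
  then show ?thesis unfolding hill_def by (simp only:) real_asymp
qed

lemma hill_even: "hill (2 * q) = real q * (real q - 1)\<^sup>2 * (real q - 2) / 4"
proof -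
  have "\<lfloor>(2 * real q - 1) / 2\<rfloor> = int q - 1" "\<lfloor>(2 * real q - 3) / 2\<rfloor> = int q - 2"
    "\<lfloor>(2 * real q - 2) / 2\<rfloor> = int q - 1"
    by (rule floor_unique; simp add: field_simps)+
  then show ?thesis by (simp add: hill_def power2_eq_square)
qed

lemma cr_S2_K_div_hill_convergent: "convergent (\<lambda>n. real (cr_S2_K n) / hill n)"
proof -
  obtain l where "(\<lambda>n. real (cr_S2_K n) / real (n choose 4)) \<longlonglongrightarrow> l"
    using convergent_div_binomial[OF cr_S2_K_step cr_S2_K_upper] by (auto simp: convergent_def)
  from tendsto_mult[OF this binomial_4_div_hill_tendsto]
  have "(\<lambda>n. real (cr_S2_K n) / real (n choose 4) * (real (n choose 4) / hill n)) \<longlonglongrightarrow> l * (8 / 3)" .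
  moreover have "\<forall>\<^sub>F n in sequentially. real (cr_S2_K n) / real (n choose 4) * (real (n choose 4) / hill n)
      = real (cr_S2_K n) / hill n"
    using eventually_ge_at_top[of 4]
  proof eventually_elim
    case (elim n)
    have "c / b * (b / h) = c / h" if "b \<noteq> 0" for b c h :: real using that by simp
    with elim show ?case by simp
  qed
  ultimately have "(\<lambda>n. real (cr_S2_K n) / hill n) \<longlonglongrightarrow> l * (8 / 3)"
    by (rule Lim_transform_eventually)
  then show ?thesis by (rule convergentI)
qed

lemma cr_S2_K_div_hill_limit_ge_1:
  assumes "(\<lambda>n. real (cr_S2_K n) / hill n) \<longlonglongrightarrow> L"
  shows "1 \<le> L"
proof (rule LIMSEQ_le)
  show "(\<lambda>q. real (cr_S2_K (2 * q)) / hill (2 * q)) \<longlonglongrightarrow> L"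
    using LIMSEQ_subseq_LIMSEQ[OF assms, of "\<lambda>q. 2 * q"] by (simp add: o_def strict_mono_def)
  show "(\<lambda>q. (real (2 * q) ^ 4 / 64 - 3 / 2 * real (2 * q) ^ 3) / hill (2 * q)) \<longlonglongrightarrow> 1"
    unfolding hill_even by simp real_asymp
  have "hill (2 * q) \<ge> 0" if "q \<ge> 2" for q using that by (simp add: hill_even)
  then show "\<exists>N. \<forall>q\<ge>N. (real (2 * q) ^ 4 / 64 - 3 / 2 * real (2 * q) ^ 3) / hill (2 * q)
      \<le> real (cr_S2_K (2 * q)) / hill (2 * q)"
    using cr_S2_K_lower by (intro exI[of _ 2]) (auto intro!: divide_right_mono)
qed

theorem theorem2:
  shows "\<exists>L :: real. (\<lambda>n. real (cr_S2_K n) / hill n) \<longlonglongrightarrow> L \<and> L > 0.99635588"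
proof -
  obtain L where limit: "(\<lambda>n. real (cr_S2_K n) / hill n) \<longlonglongrightarrow> L"
    using cr_S2_K_div_hill_convergent by (auto simp: convergent_def)
  then have "1 \<le> L" by (rule cr_S2_K_div_hill_limit_ge_1)
  then have "L > 0.99635588" by simp
  with limit show ?thesis by blast
qed

end
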